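(* Let $1<p<2$, let $T\subset\mathbb R$ be uniformly discrete, and let $\Lambda\subset T\times\mathbb R$ be countable. Then for no $g\in L^p(\mathbb R)$ and no functionals $g^*_{ts}\in(L^p(\mathbb R))^*$, $(t,s)\in\Lambda$, is the system $\{(e_s\tau_t g,\,g^*_{ts}):(t,s)\in\Lambda\}$ an unconditional Schauder frame of $L^p(\mathbb R)$. In particular, no Gabor system $\mathcal G(g;\Lambda)$ with such $\Lambda$ is an unconditional basis of $L^p(\mathbb R)$.
   Context: For $t,s\in\mathbb R$ write $(\tau_t g)(x)=g(x-t)$, $e_s(x)=e^{2\pi i s x}$, and $\mathcal G(g;\Lambda)=\{e_s\tau_t g:(t,s)\in\Lambda\}$. A set $T\subset\mathbb R$ is uniformly discrete if $\inf\{|t-t'|:t\ne t'\in T\}>0$. A family $\{(u_n,u_n^* )\}\subset X\times X^*$ is an unconditional Schauder frame of $X$ if for every $x\in X$ the series $\sum_n u_n^*(x)u_n$ converges unconditionally to $x$. An unconditional basis is a system $\{u_n\}$ such that each $x$ has a unique expansion $x=\sum c_nu_n$, which converges unconditionally. *)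

theory Defs
  imports "HOL-Analysis.Analysis"
begin

text \<open>L^p(R) (complex valued), realised as Borel measurable functions with
  integrable p-th power of the modulus; elements are compared via the L^p seminorm.\<close>

definition Lp_space :: "real \<Rightarrow> (real \<Rightarrow> complex) set" where
  "Lp_space p = {f. f \<in> borel_measurable lborel \<and>
                     integrable lborel (\<lambda>x. norm (f x) powr p)}"

definition Lp_norm :: "real \<Rightarrow> (real \<Rightarrow> complex) \<Rightarrow> real" where
  "Lp_norm p f = (\<integral>x. norm (f x) powr p \<partial>lborel) powr (1 / p)"

definition Lp_dual :: "real \<Rightarrow> ((real \<Rightarrow> complex) \<Rightarrow> complex) set" where
  "Lp_dual p = {\<phi>.
      (\<forall>f\<in>Lp_space p. \<forall>h\<in>Lp_space p. \<phi> (\<lambda>x. f x + h x) = \<phi> f + \<phi> h) \<and>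
      (\<forall>f\<in>Lp_space p. \<forall>c::complex. \<phi> (\<lambda>x. c * f x) = c * \<phi> f) \<and>
      (\<exists>C. \<forall>f\<in>Lp_space p. norm (\<phi> f) \<le> C * Lp_norm p f)}"

definition gabor :: "(real \<Rightarrow> complex) \<Rightarrow> real \<Rightarrow> real \<Rightarrow> (real \<Rightarrow> complex)" where
  "gabor g t s = (\<lambda>x. exp (2 * of_real pi * \<i> * of_real (s * x)) * g (x - t))"

definition uniformly_discrete :: "real set \<Rightarrow> bool" where
  "uniformly_discrete T \<longleftrightarrow> (\<exists>\<delta>>0. \<forall>t\<in>T. \<forall>t'\<in>T. t \<noteq> t' \<longrightarrow> \<delta> \<le> \<bar>t - t'\<bar>)"

definition Lp_uncond_sums ::
  "real \<Rightarrow> ('i \<Rightarrow> complex) \<Rightarrow> ('i \<Rightarrow> real \<Rightarrow> complex) \<Rightarrow> 'i set \<Rightarrow> (real \<Rightarrow> complex) \<Rightarrow> bool" where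
  "Lp_uncond_sums p c u I f \<longleftrightarrow>
     ((\<lambda>F. Lp_norm p (\<lambda>x. f x - (\<Sum>i\<in>F. c i * u i x))) \<longlongrightarrow> 0) (finite_subsets_at_top I)"

definition uncond_schauder_frame ::
  "real \<Rightarrow> ('i \<Rightarrow> real \<Rightarrow> complex) \<Rightarrow> ('i \<Rightarrow> (real \<Rightarrow> complex) \<Rightarrow> complex) \<Rightarrow> 'i set \<Rightarrow> bool" where
  "uncond_schauder_frame p u us I \<longleftrightarrow>
     (\<forall>f\<in>Lp_space p. Lp_uncond_sums p (\<lambda>i. us i f) u I f)"

definition uncond_basis ::
  "real \<Rightarrow> ('i \<Rightarrow> real \<Rightarrow> complex) \<Rightarrow> 'i set \<Rightarrow> bool" where
  "uncond_basis p u I \<longleftrightarrow>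
     (\<forall>f\<in>Lp_space p. (\<exists>c. Lp_uncond_sums p c u I f) \<and>
        (\<forall>c c'. Lp_uncond_sums p c u I f \<longrightarrow> Lp_uncond_sums p c' u I f \<longrightarrow>
                 (\<forall>i\<in>I. c i = c' i)))"

end

theory Submission
  imports Defs
begin

text \<open>Let \<open>f = \<Sum> c\<^sub>t\<^sub>s e\<^sub>s \<tau>\<^sub>t g\<close> converge unconditionally in \<open>L\<^sup>p\<close>, \<open>1 < p < 2\<close>, and put
  \<open>F\<^sub>t = \<Sum>\<^sub>s c\<^sub>t\<^sub>s e\<^sub>s\<close>, so that \<open>f = \<Sum>\<^sub>t F\<^sub>t \<cdot> \<tau>\<^sub>t g\<close>. The sums with bounded multipliers are bounded in
  \<open>L\<^sup>p\<close>, and Grothendieck's inequality upgrades this to a square function estimate for families of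
  multipliers. Since multiplying \<open>c\<^sub>t\<^sub>s\<close> by the unimodular number \<open>e\<^sub>s(y)\<close> translates \<open>F\<^sub>t\<close> by \<open>y\<close>,
  the square function over all translations in an interval gives local \<open>L\<^sup>2\<close> norms of \<open>F\<^sub>t\<close>,
  and \<open>\<Sum>\<^sub>t \<integral>\<^sub>[\<^sub>0\<^sub>,\<^sub>l\<^sub>] |F\<^sub>t|\<^sup>2\<close> is finite. As \<open>T\<close> is uniformly discrete, \<open>\<Sum>\<^sub>t |g(x - t)|\<^sup>p\<close>, hence also
  \<open>\<Sum>\<^sub>t |g(x - t)|\<^sup>2\<close>, is bounded on a set \<open>A \<subseteq> [0,l]\<close> of positive measure which depends on \<open>g\<close> and \<open>T\<close>
  only. By Cauchy-Schwarz \<open>f\<close> is square integrable on \<open>A\<close>, which fails for some \<open>f \<in> L\<^sup>p\<close>.\<close>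

subsection \<open>Sign averages\<close>

text \<open>The modulus of the sum is at most twice the larger one, and \<open>2 powr p\<close> is
  at most 4. This stands in for Minkowski's inequality, so that \<open>L\<^sup>p\<close> estimates
  can be carried out on integrals of p-th powers, without taking roots.\<close>

lemma powr_add_le:
  fixes a b :: complex and p :: real
  assumes "0 \<le> p" "p \<le> 2"
  shows "cmod (a + b) powr p \<le> 4 * (cmod a powr p + cmod b powr p)"
proof -
  define m where "m = max (cmod a) (cmod b)"
  have "cmod (a + b) \<le> 2 * m"
    unfolding m_def using norm_triangle_ineq[of a b] by linarith
  then have "cmod (a + b) powr p \<le> (2 * m) powr p"
    using assms by (intro powr_mono2) auto
  also have "\<dots> = 2 powr p * m powr p"
    by (simp add: m_def powr_mult)
  also have "\<dots> \<le> 4 * m powr p"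
    using powr_mono[of p 2 "2::real"] assms by (intro mult_right_mono) auto
  also have "m powr p \<le> cmod a powr p + cmod b powr p"
    unfolding m_def max_def by auto
  finally show ?thesis by simp
qed

lemma powr_convex_comb:
  fixes x y u p :: real
  assumes "1 \<le> p" "0 \<le> x" "0 \<le> y" "0 \<le> u" "u \<le> 1"
  shows "(u * x + (1 - u) * y) powr p \<le> u * x powr p + (1 - u) * y powr p"
proof -
  \<comment> \<open>Convexity will be applied to positive arguments only. When one of them is 0, a
    single scaled term remains, and \<open>v powr p \<le> v\<close> for weights in [0,1] settles
    it.\<close>
  have scale: "(v * z) powr p \<le> v * z powr p" if "0 \<le> v" "v \<le> 1" "0 \<le> z" for v z :: real
  proof (cases "v = 0")
    case False
    then have "v powr p \<le> v"
      using that powr_le_one_le[of v p] assms by auto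
    then show ?thesis
      using that by (simp add: powr_mult mult_right_mono)
  qed auto
  show ?thesis
  proof (cases "x = 0 \<or> y = 0")
    case True
    then show ?thesis using scale[of u x] scale[of "1 - u" y] assms by auto
  next
    case False
    then have "x > 0" "y > 0" using assms by auto
    then show ?thesis
      using convex_onD[OF powr_convex[OF \<open>1 \<le> p\<close>], of "1 - u" x y] assms
      by (auto simp: algebra_simps)
  qed
qed

lemma norm_convex_comb_powr:
  fixes z w :: complex and u p :: real
  assumes "1 \<le> p" "0 \<le> u" "u \<le> 1"
  shows "cmod (of_real u * z + of_real (1 - u) * w) powr p
    \<le> u * cmod z powr p + (1 - u) * cmod w powr p"
proof -
  have "cmod (of_real u * z + of_real (1 - u) * w) \<le> u * cmod z + (1 - u) * cmod w"
    by (rule norm_triangle_le) (use assms in \<open>simp add: norm_mult del: of_real_diff\<close>)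
  then have "cmod (of_real u * z + of_real (1 - u) * w) powr p \<le> (u * cmod z + (1 - u) * cmod w) powr p"
    using assms by (intro powr_mono2) auto
  also have "\<dots> \<le> u * cmod z powr p + (1 - u) * cmod w powr p"
    using assms by (intro powr_convex_comb) auto
  finally show ?thesis .
qed

text \<open>A choice of signs is encoded by the set \<open>S\<close> of indices with sign +1, so an
  expectation over independent random signs becomes a sum over \<open>Pow J\<close> divided by
  \<open>2 ^ card J\<close>.\<close>

definition rademacher :: "'j set \<Rightarrow> 'j \<Rightarrow> complex" where
  "rademacher S j = (if j \<in> S then 1 else -1)"

definition signed_sum :: "'j set \<Rightarrow> ('j \<Rightarrow> complex) \<Rightarrow> 'j set \<Rightarrow> complex" where
  "signed_sum J z S = (\<Sum>j\<in>J. rademacher S j * z j)"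

lemma sum_Pow_insert:
  assumes "finite A" "a \<notin> A"
  shows "(\<Sum>S\<in>Pow (insert a A). f S) = (\<Sum>S\<in>Pow A. f S + f (insert a S) :: 'b :: comm_monoid_add)"
proof -
  have "inj_on (insert a) (Pow A)"
    using assms by (intro inj_onI) (metis PowD insert_ident subsetD)
  moreover have "Pow A \<inter> insert a ` Pow A = {}"
    using assms by auto
  ultimately show ?thesis
    using assms by (simp add: Pow_insert sum.union_disjoint sum.reindex sum.distrib)
qed

lemma signed_sum_insert:
  assumes "finite J" "a \<notin> J" "S \<subseteq> J"
  shows "signed_sum (insert a J) z S = signed_sum J z S - z a"
    and "signed_sum (insert a J) z (insert a S) = signed_sum J z S + z a"
proof -
  have "a \<notin> S" using assms by auto
  then show "signed_sum (insert a J) z S = signed_sum J z S - z a"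
    using assms by (simp add: signed_sum_def rademacher_def)
  have "(\<Sum>j\<in>J. rademacher (insert a S) j * z j) = (\<Sum>j\<in>J. rademacher S j * z j)"
    using assms by (intro sum.cong) (auto simp: rademacher_def)
  then show "signed_sum (insert a J) z (insert a S) = signed_sum J z S + z a"
    using assms by (simp add: signed_sum_def rademacher_def)
qed

lemma cmod2_parallelogram: "(cmod (x - z))\<^sup>2 + (cmod (x + z))\<^sup>2 = 2 * (cmod x)\<^sup>2 + 2 * (cmod z)\<^sup>2"
  unfolding cmod_power2 by (simp add: power2_eq_square algebra_simps)

text \<open>Let r be the real inner product of x and z, and q the sum of their squared moduli. The
  two squared moduli on the left are q - 2r and q + 2r, their squares add up to
  \<open>2 * q\<^sup>2 + 8 * r\<^sup>2\<close>, and r is bounded by Cauchy-Schwarz.\<close>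

lemma cmod4_parallelogram:
  "cmod (x - z) ^ 4 + cmod (x + z) ^ 4
    \<le> 2 * (cmod x ^ 4 + 6 * (cmod x)\<^sup>2 * (cmod z)\<^sup>2 + cmod z ^ 4)"
proof -
  define r where "r = Re x * Re z + Im x * Im z"
  have pow4: "w ^ 4 = (w\<^sup>2)\<^sup>2" for w :: real by simp
  have m: "(cmod (x - z))\<^sup>2 = (cmod x)\<^sup>2 + (cmod z)\<^sup>2 - 2 * r"
    and p: "(cmod (x + z))\<^sup>2 = (cmod x)\<^sup>2 + (cmod z)\<^sup>2 + 2 * r"
    unfolding cmod_power2 by (simp_all add: power2_eq_square algebra_simps r_def)
  have "r\<^sup>2 + (Re x * Im z - Im x * Re z)\<^sup>2 = (cmod x)\<^sup>2 * (cmod z)\<^sup>2"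
    unfolding cmod_power2 by (simp add: power2_eq_square algebra_simps r_def)
  then have "r\<^sup>2 \<le> (cmod x)\<^sup>2 * (cmod z)\<^sup>2"
    by (metis le_add_same_cancel1 zero_le_power2)
  then show ?thesis
    unfolding pow4 m p by (simp add: power2_eq_square algebra_simps)
qed

text \<open>Orthogonality of the signs: in the average over the sign of a new index the cross terms
  cancel, which is the parallelogram law.\<close>

lemma signed_sum_second_moment:
  assumes "finite J"
  shows "(\<Sum>S\<in>Pow J. (cmod (signed_sum J z S))\<^sup>2) = 2 ^ card J * (\<Sum>j\<in>J. (cmod (z j))\<^sup>2)"
  using assms
proof (induction J)
  case empty
  then show ?case by (simp add: signed_sum_def)
next
  case (insert a J)
  have "(\<Sum>S\<in>Pow (insert a J). (cmod (signed_sum (insert a J) z S))\<^sup>2)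
    = (\<Sum>S\<in>Pow J. 2 * (cmod (signed_sum J z S))\<^sup>2 + 2 * (cmod (z a))\<^sup>2)"
    unfolding sum_Pow_insert[OF insert.hyps]
    using insert.hyps by (intro sum.cong) (simp_all add: signed_sum_insert cmod2_parallelogram)
  also have "\<dots> = 2 ^ card (insert a J) * (\<Sum>j\<in>insert a J. (cmod (z j))\<^sup>2)"
    using insert by (simp add: sum.distrib sum_distrib_left[symmetric] card_Pow algebra_simps)
  finally show ?case .
qed

lemma signed_sum_fourth_moment:
  assumes "finite J"
  shows "(\<Sum>S\<in>Pow J. cmod (signed_sum J z S) ^ 4) \<le> 3 * 2 ^ card J * (\<Sum>j\<in>J. (cmod (z j))\<^sup>2)\<^sup>2"
  using assms
proof (induction J)
  case empty
  then show ?case by (simp add: signed_sum_def)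
next
  case (insert a J)
  define \<sigma> where "\<sigma> = (\<Sum>j\<in>J. (cmod (z j))\<^sup>2)"
  have "(\<Sum>S\<in>Pow (insert a J). cmod (signed_sum (insert a J) z S) ^ 4)
    \<le> (\<Sum>S\<in>Pow J. 2 * (cmod (signed_sum J z S) ^ 4 + 6 * (cmod (signed_sum J z S))\<^sup>2 * (cmod (z a))\<^sup>2
          + cmod (z a) ^ 4))"
    unfolding sum_Pow_insert[OF insert.hyps]
    using insert.hyps by (intro sum_mono) (simp add: signed_sum_insert cmod4_parallelogram del: distrib_left_numeral)
  also have "\<dots> = 2 * (\<Sum>S\<in>Pow J. cmod (signed_sum J z S) ^ 4)
      + 12 * (\<Sum>S\<in>Pow J. (cmod (signed_sum J z S))\<^sup>2) * (cmod (z a))\<^sup>2 + 2 * 2 ^ card J * cmod (z a) ^ 4"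
    using insert.hyps
    by (simp add: sum.distrib sum_distrib_left sum_distrib_right card_Pow algebra_simps)
  also have "\<dots> \<le> 2 * (3 * 2 ^ card J * \<sigma>\<^sup>2) + 12 * (2 ^ card J * \<sigma>) * (cmod (z a))\<^sup>2
      + 2 * 2 ^ card J * cmod (z a) ^ 4"
    using insert by (simp add: signed_sum_second_moment \<sigma>_def)
  \<comment> \<open>The constant 3 is what closes the induction: expanding the square on the right
    gives exactly the mixed term with coefficient 12, and the coefficient of the fourth power only
    grows from 2 to 6.\<close>
  also have "\<dots> \<le> 3 * 2 ^ Suc (card J) * (\<sigma> + (cmod (z a))\<^sup>2)\<^sup>2"
    by (simp add: power2_eq_square algebra_simps power4_eq_xxxx)
  finally show ?case
    using insert.hyps by (simp add: \<sigma>_def add.commute)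
qed

text \<open>For u up to the threshold b the first term alone suffices, beyond b the second. Summed
  over all signs, this interpolates the second moment between the p-th and the fourth, with b free
  to be optimised.\<close>

lemma square_le_powr_plus_fourth:
  fixes u b p :: real
  assumes "0 \<le> u" "0 < b" "p \<le> 2"
  shows "u\<^sup>2 \<le> b powr (2 - p) * u powr p + u ^ 4 / b\<^sup>2"
proof (cases "u = 0")
  case False
  with assms have u: "u > 0" by simp
  show ?thesis
  proof (cases "u \<le> b")
    case True
    have "u\<^sup>2 = u powr (2 - p) * u powr p"
      using u by (simp flip: powr_add)
    also have "\<dots> \<le> b powr (2 - p) * u powr p"
      using True u assms by (intro mult_right_mono powr_mono2) auto
    finally show ?thesis using assms by (simp add: add_increasing2)
  next
    case False
    then have "u\<^sup>2 * b\<^sup>2 \<le> u\<^sup>2 * u\<^sup>2"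
      using assms by (intro mult_left_mono power_mono) auto
    then have "u\<^sup>2 \<le> u ^ 4 / b\<^sup>2"
      using assms by (simp add: field_simps flip: power_add)
    then show ?thesis by (simp add: add_increasing)
  qed
qed auto

text \<open>The second moment is dominated by the \<open>p\<close>-th and the fourth one, and the latter is
  comparable with the square of the former.\<close>

lemma khintchine_lower:
  fixes p :: real
  assumes "finite J" "1 \<le> p" "p \<le> 2"
  shows "(\<Sum>j\<in>J. (cmod (z j))\<^sup>2) powr (p / 2)
    \<le> 8 / 2 ^ card J * (\<Sum>S\<in>Pow J. cmod (signed_sum J z S) powr p)"
proof -
  define \<sigma> where "\<sigma> = (\<Sum>j\<in>J. (cmod (z j))\<^sup>2)"
  define E where "E = (\<Sum>S\<in>Pow J. cmod (signed_sum J z S) powr p)"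
  define N :: real where "N = 2 ^ card J"
  have N: "N > 0" by (simp add: N_def)
  have "E \<ge> 0" unfolding E_def by (intro sum_nonneg) auto
  show ?thesis
  proof (cases "\<sigma> = 0")
    case True
    then show ?thesis using \<open>E \<ge> 0\<close> unfolding \<sigma>_def E_def by simp
  next
    case False
    then have \<sigma>: "\<sigma> > 0" unfolding \<sigma>_def by (simp add: order_less_le sum_nonneg)
    \<comment> \<open>With this threshold the fourth moment contributes at most three quarters of
      \<open>N * \<sigma>\<close>, which is absorbed into the left-hand side.\<close>
    define b where "b = 2 * sqrt \<sigma>"
    have b: "b > 0" "b\<^sup>2 = 4 * \<sigma>" using \<sigma> by (simp_all add: b_def power_mult_distrib)
    have "N * \<sigma> = (\<Sum>S\<in>Pow J. (cmod (signed_sum J z S))\<^sup>2)"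
      using assms by (simp add: signed_sum_second_moment N_def \<sigma>_def)
    also have "\<dots> \<le> (\<Sum>S\<in>Pow J. b powr (2 - p) * cmod (signed_sum J z S) powr p
        + cmod (signed_sum J z S) ^ 4 / b\<^sup>2)"
      using b assms by (intro sum_mono square_le_powr_plus_fourth) auto
    also have "\<dots> = b powr (2 - p) * E + (\<Sum>S\<in>Pow J. cmod (signed_sum J z S) ^ 4) / b\<^sup>2"
      by (simp add: sum.distrib sum_distrib_left sum_divide_distrib E_def)
    also have "(\<Sum>S\<in>Pow J. cmod (signed_sum J z S) ^ 4) / b\<^sup>2 \<le> 3 * N * \<sigma>\<^sup>2 / b\<^sup>2"
      using signed_sum_fourth_moment[OF \<open>finite J\<close>, of z]
      by (intro divide_right_mono) (simp_all add: N_def \<sigma>_def)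
    also have "3 * N * \<sigma>\<^sup>2 / b\<^sup>2 = 3 / 4 * (N * \<sigma>)"
      using \<sigma> unfolding b by (simp add: power2_eq_square)
    finally have 1: "N * \<sigma> \<le> 4 * b powr (2 - p) * E" by simp
    have "b powr (2 - p) = 2 powr (2 - p) * \<sigma> powr (1 - p / 2)"
      using \<sigma> by (simp add: b_def powr_mult powr_powr diff_divide_distrib flip: powr_half_sqrt)
    also have "\<dots> \<le> 2 * \<sigma> powr (1 - p / 2)"
      using powr_mono[of "2 - p" 1 "2::real"] assms by (intro mult_right_mono) auto
    finally have "b powr (2 - p) * E \<le> 2 * \<sigma> powr (1 - p / 2) * E"
      using \<open>E \<ge> 0\<close> by (intro mult_right_mono)
    with 1 have "N * \<sigma> \<le> 8 * E * \<sigma> powr (1 - p / 2)"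
      by (simp add: algebra_simps)
    moreover have "\<sigma> = \<sigma> powr (p / 2) * \<sigma> powr (1 - p / 2)"
      using \<sigma> by (simp flip: powr_add)
    ultimately have "(N * \<sigma> powr (p / 2)) * \<sigma> powr (1 - p / 2) \<le> (8 * E) * \<sigma> powr (1 - p / 2)"
      by (metis mult.assoc)
    then have "N * \<sigma> powr (p / 2) \<le> 8 * E"
      using \<sigma> by (subst (asm) mult_le_cancel_right) (auto simp: not_less)
    then show ?thesis
      using N unfolding \<sigma>_def E_def N_def by (simp add: field_simps)
  qed
qed

subsection \<open>Grothendieck's inequality\<close>

text \<open>\<open>K\<close> bounds the p-th power of the norm of the operator from
  \<open>\<ell>\<^sup>\<infinity>\<close> on \<open>I\<close> to \<open>L\<^sup>p\<close> that sends
  \<open>b\<close> to the sum of the \<open>b i * v i\<close>.\<close>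

definition multiplier_bound ::
  "'a measure \<Rightarrow> 'i set \<Rightarrow> ('i \<Rightarrow> 'a \<Rightarrow> complex) \<Rightarrow> real \<Rightarrow> real \<Rightarrow> bool" where
  "multiplier_bound M I v p K \<longleftrightarrow> (\<forall>b. (\<forall>i\<in>I. cmod (b i) \<le> 1) \<longrightarrow>
     (\<integral>\<^sup>+w. ennreal (cmod (\<Sum>i\<in>I. b i * v i w) powr p) \<partial>M) \<le> ennreal K)"

text \<open>The same bound for the extension of that operator to multipliers with values in a
  finite-dimensional \<open>\<ell>\<^sup>2\<close>: the vectors \<open>(x j i)\<close> with j < n
  lie in its unit ball for each \<open>i\<close>, and \<open>D\<close> must not depend on the
  dimension n.\<close>

definition square_function_bound ::
  "'a measure \<Rightarrow> 'i set \<Rightarrow> ('i \<Rightarrow> 'a \<Rightarrow> complex) \<Rightarrow> real \<Rightarrow> real \<Rightarrow> bool" where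
  "square_function_bound M I v p D \<longleftrightarrow>
     (\<forall>(n::nat) x. (\<forall>i\<in>I. (\<Sum>j<n. (cmod (x j i))\<^sup>2) \<le> 1) \<longrightarrow>
       (\<integral>\<^sup>+w. ennreal ((\<Sum>j<n. (cmod (\<Sum>i\<in>I. x j i * v i w))\<^sup>2) powr (p / 2)) \<partial>M) \<le> ennreal D)"

text \<open>Enumerating the index set frees the definition from initial segments of
  \<open>nat\<close>; the families used below are indexed by a power set and by a product.\<close>

lemma square_function_boundD:
  fixes x :: "'j \<Rightarrow> 'i \<Rightarrow> complex"
  assumes D: "square_function_bound M I v p D" and "finite J"
    and x: "\<And>i. i \<in> I \<Longrightarrow> (\<Sum>j\<in>J. (cmod (x j i))\<^sup>2) \<le> 1"
  shows "(\<integral>\<^sup>+w. ennreal ((\<Sum>j\<in>J. (cmod (\<Sum>i\<in>I. x j i * v i w))\<^sup>2) powr (p / 2)) \<partial>M) \<le> ennreal D"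
proof -
  obtain h where h: "bij_betw h {..<card J} J"
    using ex_bij_betw_nat_finite[OF \<open>finite J\<close>] by (auto simp: atLeast0LessThan)
  have reindex: "(\<Sum>j\<in>J. F j) = (\<Sum>k<card J. F (h k))" for F :: "'j \<Rightarrow> real"
    using sum.reindex_bij_betw[OF h, of F] by simp
  show ?thesis
    using D[unfolded square_function_bound_def, rule_format, where n = "card J" and x = "\<lambda>k. x (h k)"] x
    by (simp add: reindex)
qed

lemma square_function_bound_scaled:
  fixes x :: "'j \<Rightarrow> 'i \<Rightarrow> complex"
  assumes D: "square_function_bound M I v p D" and "finite J" and [measurable]: "\<And>i. i \<in> I \<Longrightarrow> v i \<in> borel_measurable M"
    and x: "\<And>i. i \<in> I \<Longrightarrow> (\<Sum>j\<in>J. (cmod (x j i))\<^sup>2) \<le> r" and r: "r > 0"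
  shows "(\<integral>\<^sup>+w. ennreal ((\<Sum>j\<in>J. (cmod (\<Sum>i\<in>I. x j i * v i w))\<^sup>2) powr (p / 2)) \<partial>M)
    \<le> ennreal (r powr (p / 2) * D)"
proof -
  define y where "y j i = x j i / of_real (sqrt r)" for j i
  have y: "(\<Sum>j\<in>J. (cmod (y j i))\<^sup>2) \<le> 1" if "i \<in> I" for i
    using x[OF that] r by (simp add: y_def norm_divide power_divide flip: sum_divide_distrib)
  have "(\<Sum>j\<in>J. (cmod (\<Sum>i\<in>I. x j i * v i w))\<^sup>2) = r * (\<Sum>j\<in>J. (cmod (\<Sum>i\<in>I. y j i * v i w))\<^sup>2)" for w
  proof -
    have "(\<Sum>i\<in>I. y j i * v i w) = (\<Sum>i\<in>I. x j i * v i w) / of_real (sqrt r)" for j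
      by (simp add: y_def sum_divide_distrib)
    then show ?thesis
      using r by (simp add: norm_divide power_divide sum_distrib_left)
  qed
  then have "(\<integral>\<^sup>+w. ennreal ((\<Sum>j\<in>J. (cmod (\<Sum>i\<in>I. x j i * v i w))\<^sup>2) powr (p / 2)) \<partial>M)
    = (\<integral>\<^sup>+w. ennreal (r powr (p / 2)) * ennreal ((\<Sum>j\<in>J. (cmod (\<Sum>i\<in>I. y j i * v i w))\<^sup>2) powr (p / 2)) \<partial>M)"
    using r by (simp add: powr_mult sum_nonneg ennreal_mult)
  also have "\<dots> = ennreal (r powr (p / 2)) * (\<integral>\<^sup>+w. ennreal ((\<Sum>j\<in>J. (cmod (\<Sum>i\<in>I. y j i * v i w))\<^sup>2) powr (p / 2)) \<partial>M)"
    by (intro nn_integral_cmult) measurable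
  also have "\<dots> \<le> ennreal (r powr (p / 2)) * ennreal D"
    by (intro mult_left_mono square_function_boundD[OF D \<open>finite J\<close> y]) auto
  also have "\<dots> = ennreal (r powr (p / 2) * D)"
    by (simp add: ennreal_mult')
  finally show ?thesis .
qed

text \<open>The power mean inequality up to a factor 2. Let m be the mean of the squares. A term
  with square at most m has p-th power at most \<open>m powr (p / 2)\<close>; for a larger one the
  p-th power is at most \<open>m powr (p / 2 - 1)\<close> times its square. Both bounds sum to
  \<open>N * m powr (p / 2)\<close>.\<close>

lemma powr_mean_le:
  fixes a :: "'s \<Rightarrow> real" and p N :: real
  assumes "finite P" "N = card P" "N > 0" "0 < p" "p \<le> 2" "\<And>S. S \<in> P \<Longrightarrow> 0 \<le> a S"
  shows "(\<Sum>S\<in>P. a S powr p) \<le> 2 * N * ((\<Sum>S\<in>P. (a S)\<^sup>2) / N) powr (p / 2)"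
proof (cases "(\<Sum>S\<in>P. (a S)\<^sup>2) = 0")
  case True
  then have "\<forall>S\<in>P. a S = 0" using assms by (simp add: sum_nonneg_eq_0_iff)
  then show ?thesis using assms by simp
next
  case False
  define m where "m = (\<Sum>S\<in>P. (a S)\<^sup>2) / N"
  have m: "m > 0" using False assms by (simp add: m_def order_less_le sum_nonneg)
  have "a S powr p \<le> m powr (p / 2) + m powr (p / 2 - 1) * (a S)\<^sup>2" if S: "S \<in> P" for S
  proof -
    define u where "u = (a S)\<^sup>2"
    have u: "u \<ge> 0" "a S powr p = u powr (p / 2)"
      using assms(6)[OF S] by (auto simp: u_def powr_powr simp flip: powr_numeral)
    have "u powr (p / 2) \<le> m powr (p / 2) + m powr (p / 2 - 1) * u"
    proof (cases "u \<le> m")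
      case True
      then have "u powr (p / 2) \<le> m powr (p / 2)" using u assms by (intro powr_mono2) auto
      then show ?thesis using u by (simp add: add_increasing2)
    next
      case False
      have "u powr (p / 2) = u powr (p / 2 - 1) * u"
        using False m by (simp add: powr_diff)
      also have "\<dots> \<le> m powr (p / 2 - 1) * u"
        using False m assms u by (intro mult_right_mono powr_mono2') auto
      finally show ?thesis by (simp add: add_increasing)
    qed
    then show ?thesis using u by (simp add: u_def)
  qed
  then have "(\<Sum>S\<in>P. a S powr p) \<le> (\<Sum>S\<in>P. m powr (p / 2) + m powr (p / 2 - 1) * (a S)\<^sup>2)"
    by (rule sum_mono)
  also have "\<dots> = N * m powr (p / 2) + m powr (p / 2 - 1) * (N * m)"
    using assms by (simp add: sum.distrib m_def flip: sum_distrib_left)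
  also have "\<dots> = 2 * N * m powr (p / 2)"
    using m by (simp add: powr_diff)
  finally show ?thesis unfolding m_def .
qed

text \<open>Explains the truncation height 256. The factor 64 is the product of 8 from
  \<open>khintchine_lower\<close>, 4 from \<open>powr_add_le\<close> and 2 from
  \<open>powr_mean_le\<close>; the height is large enough to push the total below 1/2, so that the
  iteration contracts.\<close>

lemma truncation_constant:
  fixes p :: real
  assumes "1 \<le> p"
  shows "64 * (3 / 256\<^sup>2) powr (p / 2) \<le> 1 / 2"
proof -
  have "(3 / 256\<^sup>2 :: real) powr (p / 2) \<le> (3 / 256\<^sup>2) powr (1 / 2)"
    using assms by (intro powr_mono') auto
  also have "\<dots> = sqrt (3 / 256\<^sup>2)"
    by (simp add: powr_half_sqrt)
  also have "\<dots> \<le> 2 / 256"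
    by (rule real_le_lsqrt) (auto simp: power2_eq_square)
  finally show ?thesis by simp
qed

text \<open>Randomise with signs and truncate at height 256: the truncated part is controlled by the
  multiplier bound, and the remainders \<open>Z S\<close>, indexed by the choices of signs \<open>S\<close>, form again a family
  of multipliers, whose square function is small by the fourth moment.\<close>

lemma square_function_bound_step:
  fixes v :: "'i \<Rightarrow> 'a \<Rightarrow> complex" and p K D :: real
  assumes "finite I" "1 \<le> p" "p \<le> 2" "0 \<le> K" "0 \<le> D"
    and meas[measurable]: "\<And>i. i \<in> I \<Longrightarrow> v i \<in> borel_measurable M"
    and K: "multiplier_bound M I v p K" and D: "square_function_bound M I v p D"
  shows "square_function_bound M I v p (32 * 256 powr p * K + D / 2)"
  unfolding square_function_bound_def
proof (intro allI impI)
  fix n :: nat and x :: "nat \<Rightarrow> 'i \<Rightarrow> complex"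
  assume x: "\<forall>i\<in>I. (\<Sum>j<n. (cmod (x j i))\<^sup>2) \<le> 1"
  define N :: real where "N = 2 ^ n"
  have N: "N > 0" "N = card (Pow {..<n})" by (simp_all add: N_def card_Pow)
  define X where "X S i = signed_sum {..<n} (\<lambda>j. x j i) S" for S i
  \<comment> \<open>The truncated part divided by the height, hence an admissible multiplier. Beyond
    the height it is 0 rather than clipped, so there the remainder carries all of
    \<open>X\<close>.\<close>
  define Y where "Y S i = (if cmod (X S i) \<le> 256 then X S i / 256 else 0)" for S i
  \<comment> \<open>Dividing by \<open>sqrt N\<close> turns a sum over all choices of signs into an
    average, so the fourth moment bounds the square sum at each \<open>i\<close> independently of
    \<open>n\<close>.\<close>
  define Z where "Z S i = (X S i - 256 * Y S i) / of_real (sqrt N)" for S i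
  define T where "T b w = (\<Sum>i\<in>I. b i * v i w)" for b w
  have [measurable]: "T b \<in> borel_measurable M" for b
    unfolding T_def by measurable
  have Y: "cmod (Y S i) \<le> 1" for S i
    by (simp add: Y_def norm_divide)
  have Z: "(\<Sum>S\<in>Pow {..<n}. (cmod (Z S i))\<^sup>2) \<le> 3 / 256\<^sup>2" if "i \<in> I" for i
  proof -
    define \<sigma> where "\<sigma> = (\<Sum>j<n. (cmod (x j i))\<^sup>2)"
    have \<sigma>: "0 \<le> \<sigma>" "\<sigma> \<le> 1" using x that by (auto simp: \<sigma>_def intro: sum_nonneg)
    have "(cmod (Z S i))\<^sup>2 \<le> cmod (X S i) ^ 4 / 256\<^sup>2 / N" for S
    proof -
      have trunc: "(cmod (X S i - 256 * Y S i))\<^sup>2 \<le> cmod (X S i) ^ 4 / 256\<^sup>2"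
      proof (cases "cmod (X S i) \<le> 256")
        case False
        then have "(cmod (X S i))\<^sup>2 * 256\<^sup>2 \<le> (cmod (X S i))\<^sup>2 * (cmod (X S i))\<^sup>2"
          by (intro mult_left_mono power_mono) auto
        then show ?thesis
          using False by (simp add: Y_def field_simps flip: power_add)
      qed (simp add: Y_def)
      have "(cmod (Z S i))\<^sup>2 = (cmod (X S i - 256 * Y S i))\<^sup>2 / N"
        using N(1) by (simp add: Z_def norm_divide power_divide)
      also have "\<dots> \<le> cmod (X S i) ^ 4 / 256\<^sup>2 / N"
        using trunc N(1) by (intro divide_right_mono) auto
      finally show ?thesis .
    qed
    then have "(\<Sum>S\<in>Pow {..<n}. (cmod (Z S i))\<^sup>2) \<le> (\<Sum>S\<in>Pow {..<n}. cmod (X S i) ^ 4 / 256\<^sup>2 / N)"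
      by (intro sum_mono)
    also have "\<dots> = (\<Sum>S\<in>Pow {..<n}. cmod (X S i) ^ 4) / 256\<^sup>2 / N"
      by (simp add: sum_divide_distrib)
    also have "\<dots> \<le> 3 * N * \<sigma>\<^sup>2 / 256\<^sup>2 / N"
      using signed_sum_fourth_moment[of "{..<n}" "\<lambda>j. x j i"] N(1)
      by (intro divide_right_mono) (simp_all add: X_def N_def \<sigma>_def)
    also have "\<dots> \<le> 3 / 256\<^sup>2"
      using N(1) \<sigma> power_le_one[OF \<sigma>, of 2] by simp
    finally show ?thesis .
  qed
  have TX: "T (X S) w = signed_sum {..<n} (\<lambda>j. T (x j) w) S" for S w
    unfolding T_def X_def signed_sum_def sum_distrib_left sum_distrib_right
    by (subst sum.swap) (simp add: mult.assoc)
  have "(\<Sum>j<n. (cmod (T (x j) w))\<^sup>2) powr (p / 2)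
    \<le> 32 / N * (\<Sum>S\<in>Pow {..<n}. 256 powr p * cmod (T (Y S) w) powr p)
      + 64 * (\<Sum>S\<in>Pow {..<n}. (cmod (T (Z S) w))\<^sup>2) powr (p / 2)" for w
  proof -
    have split: "T (X S) w = 256 * T (Y S) w + of_real (sqrt N) * T (Z S) w" for S
    proof -
      have "X S i = 256 * Y S i + of_real (sqrt N) * Z S i" for i
        using N(1) by (simp add: Z_def)
      then show ?thesis
        by (simp add: T_def sum_distrib_left distrib_right sum.distrib mult.assoc)
    qed
    have "(\<Sum>j<n. (cmod (T (x j) w))\<^sup>2) powr (p / 2)
      \<le> 8 / N * (\<Sum>S\<in>Pow {..<n}. cmod (T (X S) w) powr p)"
      using khintchine_lower[of "{..<n}" p "\<lambda>j. T (x j) w"] assms by (simp add: TX N_def)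
    also have "\<dots> \<le> 8 / N * (\<Sum>S\<in>Pow {..<n}. 4 * (cmod (256 * T (Y S) w) powr p
        + cmod (of_real (sqrt N) * T (Z S) w) powr p))"
      unfolding split using N(1) assms by (intro mult_left_mono sum_mono powr_add_le) auto
    also have "\<dots> = 32 / N * (\<Sum>S\<in>Pow {..<n}. 256 powr p * cmod (T (Y S) w) powr p)
        + 32 / N * (\<Sum>S\<in>Pow {..<n}. cmod (of_real (sqrt N) * T (Z S) w) powr p)"
      by (simp add: norm_mult powr_mult sum.distrib distrib_left add_divide_distrib flip: sum_distrib_left)
    also have "(\<Sum>S\<in>Pow {..<n}. cmod (of_real (sqrt N) * T (Z S) w) powr p)
      \<le> 2 * N * ((\<Sum>S\<in>Pow {..<n}. (cmod (of_real (sqrt N) * T (Z S) w))\<^sup>2) / N) powr (p / 2)"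
      using N assms by (intro powr_mean_le) auto
    also have "(\<Sum>S\<in>Pow {..<n}. (cmod (of_real (sqrt N) * T (Z S) w))\<^sup>2) / N
      = (\<Sum>S\<in>Pow {..<n}. (cmod (T (Z S) w))\<^sup>2)"
      using N(1) by (simp add: norm_mult power_mult_distrib flip: sum_distrib_left)
    finally show ?thesis
      using N(1) by (simp add: field_simps)
  qed
  then have "(\<integral>\<^sup>+w. ennreal ((\<Sum>j<n. (cmod (T (x j) w))\<^sup>2) powr (p / 2)) \<partial>M)
    \<le> (\<integral>\<^sup>+w. ennreal (32 / N * 256 powr p) * (\<Sum>S\<in>Pow {..<n}. ennreal (cmod (T (Y S) w) powr p))
      + 64 * ennreal ((\<Sum>S\<in>Pow {..<n}. (cmod (T (Z S) w))\<^sup>2) powr (p / 2)) \<partial>M)"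
    using N(1)
    by (intro nn_integral_mono)
      (simp add: ennreal_leI sum_nonneg mult.assoc flip: ennreal_numeral ennreal_mult ennreal_plus sum_distrib_left)
  also have "\<dots> = ennreal (32 / N * 256 powr p) * (\<Sum>S\<in>Pow {..<n}. \<integral>\<^sup>+w. ennreal (cmod (T (Y S) w) powr p) \<partial>M)
      + 64 * (\<integral>\<^sup>+w. ennreal ((\<Sum>S\<in>Pow {..<n}. (cmod (T (Z S) w))\<^sup>2) powr (p / 2)) \<partial>M)"
    by (simp add: nn_integral_add nn_integral_cmult nn_integral_sum del: sum_ennreal)
  also have "\<dots> \<le> ennreal (32 / N * 256 powr p) * (\<Sum>S\<in>Pow {..<n}. ennreal K)
      + 64 * ennreal ((3 / 256\<^sup>2) powr (p / 2) * D)"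
  proof (intro add_mono mult_left_mono sum_mono)
    show "(\<integral>\<^sup>+w. ennreal (cmod (T (Y S) w) powr p) \<partial>M) \<le> ennreal K" for S
      unfolding T_def using K[unfolded multiplier_bound_def, rule_format, of "Y S"] Y by simp
    show "(\<integral>\<^sup>+w. ennreal ((\<Sum>S\<in>Pow {..<n}. (cmod (T (Z S) w))\<^sup>2) powr (p / 2)) \<partial>M)
      \<le> ennreal ((3 / 256\<^sup>2) powr (p / 2) * D)"
      unfolding T_def using Z by (intro square_function_bound_scaled[OF D] meas) auto
  qed auto
  also have "\<dots> = ennreal (32 * 256 powr p * K + 64 * (3 / 256\<^sup>2) powr (p / 2) * D)"
  proof -
    have "(\<Sum>S\<in>Pow {..<n}. ennreal K) = ennreal (N * K)"
      using assms N(2) by (simp only: sum_constant ennreal_mult ennreal_of_nat_eq_real_of_nat of_nat_0_le_iff)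
    then show ?thesis
      using N(1) assms by (simp del: sum_constant flip: ennreal_mult ennreal_plus ennreal_numeral)
  qed
  also have "\<dots> \<le> ennreal (32 * 256 powr p * K + D / 2)"
    using mult_right_mono[OF truncation_constant[OF \<open>1 \<le> p\<close>] \<open>0 \<le> D\<close>] by (intro ennreal_leI) simp
  finally show "(\<integral>\<^sup>+w. ennreal ((\<Sum>j<n. (cmod (\<Sum>i\<in>I. x j i * v i w))\<^sup>2) powr (p / 2)) \<partial>M)
    \<le> ennreal (32 * 256 powr p * K + D / 2)"
    unfolding T_def .
qed

text \<open>Only finiteness of the constant matters: it starts the iteration, and its dependence on
  \<open>card I\<close> disappears in the limit. Cauchy-Schwarz over \<open>I\<close> bounds the
  square function by the sum of the moduli of the \<open>v i\<close>, and each single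
  \<open>v i\<close> comes from a 0-1 multiplier.\<close>

lemma square_function_bound_crude:
  fixes v :: "'i \<Rightarrow> 'a \<Rightarrow> complex" and p K :: real
  assumes "finite I" "0 < p" "0 \<le> K"
    and meas[measurable]: "\<And>i. i \<in> I \<Longrightarrow> v i \<in> borel_measurable M"
    and K: "multiplier_bound M I v p K"
  shows "square_function_bound M I v p (card I powr p * (card I * K))"
  unfolding square_function_bound_def
proof (intro allI impI)
  fix n :: nat and x :: "nat \<Rightarrow> 'i \<Rightarrow> complex"
  assume x: "\<forall>i\<in>I. (\<Sum>j<n. (cmod (x j i))\<^sup>2) \<le> 1"
  have "(\<Sum>j<n. (cmod (\<Sum>i\<in>I. x j i * v i w))\<^sup>2) powr (p / 2)
    \<le> card I powr p * (\<Sum>i\<in>I. cmod (v i w) powr p)" for w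
  proof -
    define V where "V = (\<Sum>i\<in>I. cmod (v i w))"
    have V0: "V \<ge> 0" by (simp add: V_def sum_nonneg)
    \<comment> \<open>The weight \<open>cmod (v i w)\<close> is split into two square roots, so that
      one factor is independent of \<open>j\<close> and the hypothesis on \<open>x\<close> can be
      used after summing over \<open>j\<close>.\<close>
    have "(cmod (\<Sum>i\<in>I. x j i * v i w))\<^sup>2 \<le> (\<Sum>i\<in>I. (cmod (x j i))\<^sup>2 * cmod (v i w)) * V" for j
    proof -
      have "cmod (\<Sum>i\<in>I. x j i * v i w) \<le> (\<Sum>i\<in>I. (cmod (x j i) * sqrt (cmod (v i w))) * sqrt (cmod (v i w)))"
        by (rule sum_norm_le) (simp add: norm_mult mult.assoc)
      then have "(cmod (\<Sum>i\<in>I. x j i * v i w))\<^sup>2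
        \<le> (\<Sum>i\<in>I. (cmod (x j i) * sqrt (cmod (v i w))) * sqrt (cmod (v i w)))\<^sup>2"
        by (intro power_mono) auto
      also have "\<dots> \<le> (\<Sum>i\<in>I. (cmod (x j i) * sqrt (cmod (v i w)))\<^sup>2) * (\<Sum>i\<in>I. (sqrt (cmod (v i w)))\<^sup>2)"
        by (rule Cauchy_Schwarz_ineq_sum)
      finally show ?thesis by (simp add: V_def power_mult_distrib)
    qed
    then have "(\<Sum>j<n. (cmod (\<Sum>i\<in>I. x j i * v i w))\<^sup>2)
      \<le> (\<Sum>j<n. (\<Sum>i\<in>I. (cmod (x j i))\<^sup>2 * cmod (v i w)) * V)"
      by (rule sum_mono)
    also have "\<dots> = (\<Sum>i\<in>I. (\<Sum>j<n. (cmod (x j i))\<^sup>2) * cmod (v i w)) * V"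
      by (simp add: sum_distrib_right sum.swap[of _ I])
    also have "\<dots> \<le> (\<Sum>i\<in>I. 1 * cmod (v i w)) * V"
      using x V0 by (intro mult_right_mono sum_mono) auto
    also have "\<dots> = V\<^sup>2" by (simp add: V_def power2_eq_square)
    finally have "(\<Sum>j<n. (cmod (\<Sum>i\<in>I. x j i * v i w))\<^sup>2) powr (p / 2) \<le> (V\<^sup>2) powr (p / 2)"
      using assms by (intro powr_mono2) (auto intro: sum_nonneg)
    also have "\<dots> = V powr p"
      using V0 by (simp add: powr_powr flip: powr_numeral)
    also have "\<dots> \<le> card I powr p * (\<Sum>i\<in>I. cmod (v i w) powr p)"
    proof (cases "I = {}")
      case False
      define m where "m = Max ((\<lambda>i. cmod (v i w)) ` I)"
      have "m \<in> (\<lambda>i. cmod (v i w)) ` I"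
        unfolding m_def using False assms by (intro Max_in) auto
      then obtain k where k: "k \<in> I" "m = cmod (v k w)" by auto
      have "V \<le> card I * m"
        unfolding V_def m_def using assms by (intro sum_bounded_above) auto
      then have "V powr p \<le> (card I * m) powr p"
        using V0 assms by (intro powr_mono2) auto
      also have "\<dots> = card I powr p * cmod (v k w) powr p"
        using k by (simp add: powr_mult)
      also have "\<dots> \<le> card I powr p * (\<Sum>i\<in>I. cmod (v i w) powr p)"
        using k assms by (intro mult_left_mono member_le_sum) auto
      finally show ?thesis .
    qed (simp add: V_def)
    finally show ?thesis .
  qed
  then have "(\<integral>\<^sup>+w. ennreal ((\<Sum>j<n. (cmod (\<Sum>i\<in>I. x j i * v i w))\<^sup>2) powr (p / 2)) \<partial>M)
    \<le> (\<integral>\<^sup>+w. ennreal (card I powr p) * (\<Sum>i\<in>I. ennreal (cmod (v i w) powr p)) \<partial>M)"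
    by (intro nn_integral_mono) (simp add: ennreal_leI sum_nonneg flip: ennreal_mult)
  also have "\<dots> = ennreal (card I powr p) * (\<Sum>i\<in>I. \<integral>\<^sup>+w. ennreal (cmod (v i w) powr p) \<partial>M)"
    by (simp add: nn_integral_cmult nn_integral_sum del: sum_ennreal)
  also have "\<dots> \<le> ennreal (card I powr p) * (\<Sum>i\<in>I. ennreal K)"
  proof (intro mult_left_mono sum_mono)
    fix i assume "i \<in> I"
    then have "(\<Sum>k\<in>I. (if k = i then 1 else 0) * v k w) = v i w" for w
      using assms by (simp add: if_distrib[of "\<lambda>c. c * _"] cong: if_cong)
    then show "(\<integral>\<^sup>+w. ennreal (cmod (v i w) powr p) \<partial>M) \<le> ennreal K"
      using K[unfolded multiplier_bound_def, rule_format, of "\<lambda>k. if k = i then 1 else 0"] by simp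
  qed auto
  also have "\<dots> = ennreal (card I powr p * (card I * K))"
    using assms by (simp add: ennreal_mult ennreal_of_nat_eq_real_of_nat)
  finally show "(\<integral>\<^sup>+w. ennreal ((\<Sum>j<n. (cmod (\<Sum>i\<in>I. x j i * v i w))\<^sup>2) powr (p / 2)) \<partial>M)
    \<le> ennreal (card I powr p * (card I * K))" .
qed

text \<open>Grothendieck's inequality for operators from \<open>\<ell>\<^sup>\<infinity>\<close> to \<open>L\<^sup>p\<close>: the affine map
  \<open>D \<mapsto> A + D/2\<close> improves any admissible constant \<open>D\<close>, so its fixed point \<open>2A\<close> is admissible.\<close>

lemma square_function_bound_of_multiplier_bound:
  fixes v :: "'i \<Rightarrow> 'a \<Rightarrow> complex" and p K :: real
  assumes "finite I" "1 \<le> p" "p \<le> 2" "0 \<le> K"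
    and "\<And>i. i \<in> I \<Longrightarrow> v i \<in> borel_measurable M"
    and "multiplier_bound M I v p K"
  shows "square_function_bound M I v p (64 * 256 powr p * K)"
proof -
  define A where "A = 32 * 256 powr p * K"
  define D where "D = card I powr p * (card I * K)"
  have A0: "A \<ge> 0" and D0: "D \<ge> 0" using assms by (simp_all add: A_def D_def)
  have "square_function_bound M I v p (2 * A + D / 2 ^ k)" for k
  proof (induction k)
    case 0
    have "square_function_bound M I v p D"
      unfolding D_def using assms by (intro square_function_bound_crude) auto
    moreover have "ennreal D \<le> ennreal (2 * A + D)" using A0 by (intro ennreal_leI) simp
    ultimately show ?case
      unfolding square_function_bound_def by (auto intro: order_trans)
  next
    case (Suc k)
    have "square_function_bound M I v p (A + (2 * A + D / 2 ^ k) / 2)"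
      unfolding A_def using Suc A0 D0 assms by (intro square_function_bound_step) (auto simp: A_def)
    then show ?case by (simp add: field_simps)
  qed
  moreover have "(\<lambda>k. ennreal (2 * A + D / 2 ^ k)) \<longlonglongrightarrow> ennreal (2 * A + 0)"
    by (intro tendsto_ennrealI tendsto_add tendsto_const LIMSEQ_divide_realpow_zero) auto
  ultimately have "square_function_bound M I v p (2 * A)"
    unfolding square_function_bound_def by (auto intro!: LIMSEQ_le_const)
  then show ?thesis by (simp add: A_def mult.assoc)
qed

subsection \<open>Unconditional sums and multipliers\<close>

lemma nn_integral_convex_comb_powr:
  fixes z w :: "'a \<Rightarrow> complex" and u p B :: real
  assumes "1 \<le> p" "0 \<le> u" "u \<le> 1"
    and [measurable]: "z \<in> borel_measurable M" "w \<in> borel_measurable M"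
    and z: "(\<integral>\<^sup>+x. ennreal (cmod (z x) powr p) \<partial>M) \<le> ennreal B"
    and w: "(\<integral>\<^sup>+x. ennreal (cmod (w x) powr p) \<partial>M) \<le> ennreal B"
  shows "(\<integral>\<^sup>+x. ennreal (cmod (of_real u * z x + of_real (1 - u) * w x) powr p) \<partial>M) \<le> ennreal B"
proof -
  have "(\<integral>\<^sup>+x. ennreal (cmod (of_real u * z x + of_real (1 - u) * w x) powr p) \<partial>M)
    \<le> (\<integral>\<^sup>+x. ennreal u * ennreal (cmod (z x) powr p) + ennreal (1 - u) * ennreal (cmod (w x) powr p) \<partial>M)"
    using norm_convex_comb_powr[OF assms(1-3)] assms(2,3)
    by (intro nn_integral_mono) (simp add: ennreal_leI flip: ennreal_mult ennreal_plus)
  also have "\<dots> = ennreal u * (\<integral>\<^sup>+x. ennreal (cmod (z x) powr p) \<partial>M)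
      + ennreal (1 - u) * (\<integral>\<^sup>+x. ennreal (cmod (w x) powr p) \<partial>M)"
    by (simp add: nn_integral_add nn_integral_cmult)
  also have "\<dots> \<le> ennreal u * ennreal B + ennreal (1 - u) * ennreal B"
    by (intro add_mono mult_left_mono z w) auto
  also have "\<dots> = ennreal B"
    using assms(2,3) by (simp flip: distrib_right ennreal_plus)
  finally show ?thesis .
qed

text \<open>A sum with weights in [0,1] is a convex combination of subset sums. The induction
  settles one weight at a time; the offset \<open>w\<close> collects the terms already decided,
  hence it is generalised.\<close>

lemma nn_integral_unit_multiplier:
  fixes v :: "'i \<Rightarrow> 'a \<Rightarrow> complex" and p B :: real
  assumes "finite I" "1 \<le> p"
    and "\<And>i. i \<in> I \<Longrightarrow> v i \<in> borel_measurable M" "w \<in> borel_measurable M"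
    and "\<And>i. i \<in> I \<Longrightarrow> 0 \<le> b i \<and> b i \<le> (1::real)"
    and "\<And>S. S \<subseteq> I \<Longrightarrow> (\<integral>\<^sup>+x. ennreal (cmod (w x + (\<Sum>i\<in>S. v i x)) powr p) \<partial>M) \<le> ennreal B"
  shows "(\<integral>\<^sup>+x. ennreal (cmod (w x + (\<Sum>i\<in>I. of_real (b i) * v i x)) powr p) \<partial>M) \<le> ennreal B"
  using assms(1,3-)
proof (induction I arbitrary: w)
  case (insert a I)
  have [measurable]: "w \<in> borel_measurable M" "\<And>i. i \<in> insert a I \<Longrightarrow> v i \<in> borel_measurable M"
    using insert.prems by auto
  define R where "R x = (\<Sum>i\<in>I. of_real (b i) * v i x)" for x
  have [measurable]: "R \<in> borel_measurable M" unfolding R_def by measurable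
  have "(\<integral>\<^sup>+x. ennreal (cmod (w x + v a x + R x) powr p) \<partial>M) \<le> ennreal B"
    unfolding R_def
  proof (rule insert.IH)
    fix S assume "S \<subseteq> I"
    then have "finite S" "a \<notin> S" using insert.hyps by (auto intro: finite_subset)
    then show "(\<integral>\<^sup>+x. ennreal (cmod (w x + v a x + (\<Sum>i\<in>S. v i x)) powr p) \<partial>M) \<le> ennreal B"
      using insert.prems(4)[of "insert a S"] \<open>S \<subseteq> I\<close> by (simp add: add.assoc subset_insertI2 insert_mono)
  qed (use insert.prems in auto)
  moreover have "(\<integral>\<^sup>+x. ennreal (cmod (w x + R x) powr p) \<partial>M) \<le> ennreal B"
    unfolding R_def using insert.prems by (intro insert.IH) auto
  ultimately have "(\<integral>\<^sup>+x. ennreal (cmod (of_real (b a) * (w x + v a x + R x)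
      + of_real (1 - b a) * (w x + R x)) powr p) \<partial>M) \<le> ennreal B"
    using insert.prems(3)[of a] assms(2) by (intro nn_integral_convex_comb_powr) auto
  moreover have "of_real (b a) * (w x + v a x + R x) + of_real (1 - b a) * (w x + R x)
    = w x + (\<Sum>i\<in>insert a I. of_real (b i) * v i x)" for x
    using insert.hyps by (simp add: R_def algebra_simps)
  ultimately show ?case by simp
qed auto

lemma nn_integral_powr_add_le:
  fixes z w :: "'a \<Rightarrow> complex" and p B C :: real
  assumes "0 \<le> p" "p \<le> 2" "0 \<le> B" "0 \<le> C"
    and [measurable]: "z \<in> borel_measurable M" "w \<in> borel_measurable M"
    and z: "(\<integral>\<^sup>+x. ennreal (cmod (z x) powr p) \<partial>M) \<le> ennreal B"
    and w: "(\<integral>\<^sup>+x. ennreal (cmod (w x) powr p) \<partial>M) \<le> ennreal C"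
  shows "(\<integral>\<^sup>+x. ennreal (cmod (z x + w x) powr p) \<partial>M) \<le> ennreal (4 * (B + C))"
proof -
  have "(\<integral>\<^sup>+x. ennreal (cmod (z x + w x) powr p) \<partial>M)
    \<le> (\<integral>\<^sup>+x. 4 * (ennreal (cmod (z x) powr p) + ennreal (cmod (w x) powr p)) \<partial>M)"
    using powr_add_le[OF assms(1,2)]
    by (intro nn_integral_mono) (simp add: ennreal_leI flip: ennreal_numeral ennreal_mult ennreal_plus)
  also have "\<dots> = 4 * ((\<integral>\<^sup>+x. ennreal (cmod (z x) powr p) \<partial>M) + (\<integral>\<^sup>+x. ennreal (cmod (w x) powr p) \<partial>M))"
    by (simp add: nn_integral_add nn_integral_cmult)
  also have "\<dots> \<le> 4 * (ennreal B + ennreal C)"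
    by (intro add_mono mult_left_mono z w) auto
  also have "\<dots> = ennreal (4 * (B + C))"
    using assms by (simp flip: ennreal_numeral ennreal_mult ennreal_plus)
  finally show ?thesis .
qed

text \<open>A multiplier in the unit disc is split into the positive and negative parts of its real
  and imaginary parts, four multipliers with values in [0,1]. Adding them in two rounds of
  \<open>nn_integral_powr_add_le\<close> costs the factor 64.\<close>

lemma multiplier_bound_of_subset_sums:
  fixes v :: "'i \<Rightarrow> 'a \<Rightarrow> complex" and p B :: real
  assumes "finite I" "1 \<le> p" "p \<le> 2" "0 \<le> B"
    and [measurable]: "\<And>i. i \<in> I \<Longrightarrow> v i \<in> borel_measurable M"
    and S: "\<And>S. S \<subseteq> I \<Longrightarrow> (\<integral>\<^sup>+x. ennreal (cmod (\<Sum>i\<in>S. v i x) powr p) \<partial>M) \<le> ennreal B"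
  shows "multiplier_bound M I v p (64 * B)"
  unfolding multiplier_bound_def
proof (intro allI impI)
  fix b :: "'i \<Rightarrow> complex" assume b: "\<forall>i\<in>I. cmod (b i) \<le> 1"
  define s where "s r x = (\<Sum>i\<in>I. of_real (max 0 (r (b i))) * v i x)" for r :: "complex \<Rightarrow> real" and x
  have [measurable]: "s r \<in> borel_measurable M" for r
    unfolding s_def by measurable
  have s: "(\<integral>\<^sup>+x. ennreal (cmod (c * s r x) powr p) \<partial>M) \<le> ennreal B"
    if "\<And>z. r z \<le> cmod z" "cmod c = 1" for r c
  proof -
    have "0 \<le> max 0 (r (b i)) \<and> max 0 (r (b i)) \<le> 1" if "i \<in> I" for i
      using b \<open>\<And>z. r z \<le> cmod z\<close>[of "b i"] that by fastforce
    then show ?thesis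
      using nn_integral_unit_multiplier[where w = "\<lambda>_. 0" and b = "\<lambda>i. max 0 (r (b i))" and v = v and M = M and p = p and B = B, OF assms(1,2)] S assms(5)
      by (simp add: s_def norm_mult \<open>cmod c = 1\<close>)
  qed
  have "of_real (max 0 (Re z)) + (-1) * of_real (max 0 (- Re z))
      + (\<i> * of_real (max 0 (Im z)) + (- \<i>) * of_real (max 0 (- Im z))) = z" for z
    by (auto simp: complex_eq_iff max_def)
  then have "(\<Sum>i\<in>I. b i * v i x) = (1 * s Re x + (-1) * s (\<lambda>z. - Re z) x)
      + (\<i> * s Im x + (- \<i>) * s (\<lambda>z. - Im z) x)" for x
    unfolding s_def sum_distrib_left sum.distrib[symmetric]
    by (intro sum.cong refl) (metis (no_types, lifting) distrib_right mult.assoc mult_1)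
  then show "(\<integral>\<^sup>+x. ennreal (cmod (\<Sum>i\<in>I. b i * v i x) powr p) \<partial>M) \<le> ennreal (64 * B)"
  proof -
    have *: "- Re z \<le> cmod z" "- Im z \<le> cmod z" "Im z \<le> cmod z" for z
      using abs_Re_le_cmod[of z] abs_Im_le_cmod[of z] by linarith+
    have "(\<integral>\<^sup>+x. ennreal (cmod ((1 * s Re x + (-1) * s (\<lambda>z. - Re z) x)
      + (\<i> * s Im x + (- \<i>) * s (\<lambda>z. - Im z) x)) powr p) \<partial>M) \<le> ennreal (4 * (4 * (B + B) + 4 * (B + B)))"
      using assms(2-4) * complex_Re_le_cmod
      by (intro nn_integral_powr_add_le s) auto
    then show ?thesis
      by (simp add: \<open>\<And>x. (\<Sum>i\<in>I. b i * v i x) = _ x\<close>)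
  qed
qed

section \<open>Membership in \<open>Lp_space\<close> through nonnegative integrals\<close>

lemma Lp_space_nn_integral:
  assumes "h \<in> Lp_space p"
  shows "(\<integral>\<^sup>+x. ennreal (cmod (h x) powr p) \<partial>lborel) = ennreal (\<integral>x. cmod (h x) powr p \<partial>lborel)"
  using assms by (intro nn_integral_eq_integral) (auto simp: Lp_space_def)

lemma Lp_norm_powr:
  assumes "h \<in> Lp_space p" "0 < p"
  shows "(\<integral>\<^sup>+x. ennreal (cmod (h x) powr p) \<partial>lborel) = ennreal (Lp_norm p h powr p)"
  using assms by (simp add: Lp_space_nn_integral Lp_norm_def powr_powr)

lemma Lp_space_measurable:
  "h \<in> Lp_space p \<Longrightarrow> h \<in> borel_measurable borel"
  by (simp add: Lp_space_def)

lemma Lp_space_iff: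
  "h \<in> Lp_space p \<longleftrightarrow> h \<in> borel_measurable borel \<and> (\<integral>\<^sup>+x. ennreal (cmod (h x) powr p) \<partial>lborel) < \<infinity>"
  by (auto simp: Lp_space_def integrable_iff_bounded)

lemma Lp_space_add:
  assumes "f \<in> Lp_space p" "h \<in> Lp_space p" "0 < p" "p \<le> 2"
  shows "(\<lambda>x. f x + h x) \<in> Lp_space p"
proof -
  note [measurable] = assms(1,2)[THEN Lp_space_measurable]
  have "(\<integral>\<^sup>+x. ennreal (cmod (f x + h x) powr p) \<partial>lborel)
    \<le> ennreal (4 * (Lp_norm p f powr p + Lp_norm p h powr p))"
    using assms by (intro nn_integral_powr_add_le) (auto simp: Lp_norm_powr)
  then show ?thesis
    unfolding Lp_space_iff by (auto intro: le_less_trans)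
qed

lemma Lp_space_cmult:
  assumes "f \<in> Lp_space p"
  shows "(\<lambda>x. c * f x) \<in> Lp_space p"
  using assms by (auto simp: Lp_space_def norm_mult powr_mult)

lemma Lp_space_sum:
  assumes "\<And>i. i \<in> I \<Longrightarrow> u i \<in> Lp_space p" "0 < p" "p \<le> 2"
  shows "(\<lambda>x. \<Sum>i\<in>I. c i * u i x) \<in> Lp_space p"
  using assms(1)
proof (induction I rule: infinite_finite_induct)
  case (insert a I)
  then show ?case
    using assms by (simp add: Lp_space_add Lp_space_cmult)
qed (auto simp: Lp_space_def)

lemma uncond_sums_eventually:
  fixes p :: real
  assumes sums: "Lp_uncond_sums p c u I f" and f: "f \<in> Lp_space p"
    and u: "\<And>i. i \<in> I \<Longrightarrow> u i \<in> Lp_space p" and p: "0 < p" "p \<le> 2" and "\<epsilon> > 0"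
  shows "\<forall>\<^sub>F F in finite_subsets_at_top I.
    (\<integral>\<^sup>+x. ennreal (cmod (f x - (\<Sum>i\<in>F. c i * u i x)) powr p) \<partial>lborel) \<le> ennreal \<epsilon>"
proof -
  have "\<forall>\<^sub>F F in finite_subsets_at_top I.
    Lp_norm p (\<lambda>x. f x - (\<Sum>i\<in>F. c i * u i x)) < \<epsilon> powr (1 / p)"
    using order_tendstoD(2)[OF sums[unfolded Lp_uncond_sums_def]] \<open>\<epsilon> > 0\<close> by simp
  moreover have "\<forall>\<^sub>F F in finite_subsets_at_top I. F \<subseteq> I"
    by (auto simp: eventually_finite_subsets_at_top)
  ultimately show ?thesis
  proof eventually_elim
    case (elim F)
    \<comment> \<open>\<open>Lp_norm\<close> is built on the Bochner integral, which is 0 for a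
      non-integrable function. Membership in \<open>Lp_space\<close> is therefore established before
      a small \<open>Lp_norm\<close> is read as a small nonnegative integral.\<close>
    have "(\<lambda>x. f x + (-1) * (\<Sum>i\<in>F. c i * u i x)) \<in> Lp_space p"
      using elim u p f by (intro Lp_space_add Lp_space_cmult Lp_space_sum) auto
    then have "(\<lambda>x. f x - (\<Sum>i\<in>F. c i * u i x)) \<in> Lp_space p" by simp
    moreover have "Lp_norm p (\<lambda>x. f x - (\<Sum>i\<in>F. c i * u i x)) powr p \<le> (\<epsilon> powr (1 / p)) powr p"
      using elim p by (intro powr_mono2) (auto simp: Lp_norm_def)
    ultimately show ?case
      using p \<open>\<epsilon> > 0\<close> by (simp add: Lp_norm_powr powr_powr ennreal_leI)
  qed
qed

text \<open>From some finite \<open>F0\<close> on, partial sums stay close to \<open>f\<close>. A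
  sum over an arbitrary finite \<open>F\<close> is the sum over \<open>F0 \<union> F\<close> minus
  the sum over \<open>F0 - F\<close>; the latter is one of finitely many functions. Hence all subset
  sums are bounded by one constant, depending on \<open>f\<close> and \<open>c\<close>.\<close>

lemma uncond_sums_multiplier_bound:
  fixes p :: real
  assumes sums: "Lp_uncond_sums p c u I f" and f: "f \<in> Lp_space p"
    and u: "\<And>i. i \<in> I \<Longrightarrow> u i \<in> Lp_space p" and p: "1 \<le> p" "p \<le> 2"
  obtains K where "K \<ge> 0"
    "\<And>F. finite F \<Longrightarrow> F \<subseteq> I \<Longrightarrow> multiplier_bound lborel F (\<lambda>i x. c i * u i x) p K"
proof -
  obtain F0 where F0: "finite F0" "F0 \<subseteq> I"
    and le1: "\<And>F. finite F \<Longrightarrow> F0 \<subseteq> F \<Longrightarrow> F \<subseteq> I \<Longrightarrow>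
      (\<integral>\<^sup>+x. ennreal (cmod (f x - (\<Sum>i\<in>F. c i * u i x)) powr p) \<partial>lborel) \<le> ennreal 1"
    using uncond_sums_eventually[OF sums f u, of 1] p unfolding eventually_finite_subsets_at_top by auto
  define s where "s F x = (\<Sum>i\<in>F. c i * u i x)" for F x
  have s: "s F \<in> Lp_space p" if "F \<subseteq> I" for F
    unfolding s_def using that u p by (intro Lp_space_sum) auto
  define C where "C = (\<Sum>F\<in>Pow F0. Lp_norm p (s F) powr p)"
  have C: "C \<ge> 0" by (simp add: C_def sum_nonneg)
  define B where "B = 4 * (4 * (1 + Lp_norm p f powr p) + C)"
  have B: "B \<ge> 0" using C by (simp add: B_def)
  have bound: "(\<integral>\<^sup>+x. ennreal (cmod (s F x) powr p) \<partial>lborel) \<le> ennreal B" if "finite F" "F \<subseteq> I" for F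
  proof -
    have I: "F0 \<union> F \<subseteq> I" "F0 - F \<subseteq> I" using F0 that by auto
    note [measurable] = f[THEN Lp_space_measurable] I[THEN s, THEN Lp_space_measurable]
    have "s F x = - (f x - s (F0 \<union> F) x) + f x + - s (F0 - F) x" for x
    proof -
      have "s (F0 \<union> F) x = s F x + s (F0 - F) x"
        unfolding s_def using F0 that by (subst sum.union_disjoint[symmetric]) (auto intro!: sum.cong)
      then show ?thesis by simp
    qed
    moreover have "(\<integral>\<^sup>+x. ennreal (cmod (- (f x - s (F0 \<union> F) x) + f x + - s (F0 - F) x) powr p) \<partial>lborel)
      \<le> ennreal B"
      unfolding B_def
    proof (intro nn_integral_powr_add_le)
      show "(\<integral>\<^sup>+x. ennreal (cmod (- (f x - s (F0 \<union> F) x)) powr p) \<partial>lborel) \<le> ennreal 1"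
        using le1[of "F0 \<union> F"] F0 that unfolding s_def norm_minus_cancel by auto
      show "(\<integral>\<^sup>+x. ennreal (cmod (f x) powr p) \<partial>lborel) \<le> ennreal (Lp_norm p f powr p)"
        using f p by (simp add: Lp_norm_powr)
      have "Lp_norm p (s (F0 - F)) powr p \<le> C"
        unfolding C_def using F0 by (intro member_le_sum) auto
      then show "(\<integral>\<^sup>+x. ennreal (cmod (- s (F0 - F) x) powr p) \<partial>lborel) \<le> ennreal C"
        using s[OF I(2)] p by (simp add: Lp_norm_powr ennreal_leI)
    qed (use p C in auto)
    ultimately show ?thesis by simp
  qed
  have "multiplier_bound lborel F (\<lambda>i x. c i * u i x) p (64 * B)" if "finite F" "F \<subseteq> I" for F
  proof (rule multiplier_bound_of_subset_sums)
    fix S assume "S \<subseteq> F"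
    then show "(\<integral>\<^sup>+x. ennreal (cmod (\<Sum>i\<in>S. c i * u i x) powr p) \<partial>lborel) \<le> ennreal B"
      using bound[of S] that finite_subset[of S F] unfolding s_def by auto
  next
    fix i assume "i \<in> F"
    then have "(\<lambda>x. c i * u i x) \<in> Lp_space p" using u that by (intro Lp_space_cmult) auto
    then show "(\<lambda>x. c i * u i x) \<in> borel_measurable lborel"
      by (simp add: Lp_space_measurable)
  qed (use that p B in auto)
  then show ?thesis using B by (intro that[of "64 * B"]) auto
qed

subsection \<open>Local square integrability of the fibres\<close>

text \<open>The inclusion of \<open>\<ell>\<^sup>q\<close> in \<open>\<ell>\<^sup>1\<close>: each
  term is at most \<open>E powr (1 / q)\<close>, so \<open>b i\<close> exceeds
  \<open>b i powr q\<close> at most by the factor \<open>E powr (1 / q - 1)\<close>. It is applied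
  with q = p/2.\<close>

lemma sum_le_powr_of_sum_powr_le:
  fixes b :: "'i \<Rightarrow> real" and q E :: real
  assumes "finite I" "0 < q" "q \<le> 1" and b: "\<And>i. i \<in> I \<Longrightarrow> 0 \<le> b i"
    and E: "(\<Sum>i\<in>I. b i powr q) \<le> E"
  shows "(\<Sum>i\<in>I. b i) \<le> E powr (1 / q)"
proof -
  have E0: "0 \<le> E" using E by (rule order_trans[rotated]) (intro sum_nonneg, auto)
  have "b i \<le> b i powr q * E powr (1 / q - 1)" if i: "i \<in> I" for i
  proof -
    have "b i powr q \<le> (\<Sum>i\<in>I. b i powr q)"
      using i assms by (intro member_le_sum) auto
    then have "b i powr q \<le> E" using E by simp
    then have "(b i powr q) powr (1 / q - 1) \<le> E powr (1 / q - 1)"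
      using assms by (intro powr_mono2) (auto simp: field_simps)
    moreover have "b i = b i powr q * (b i powr q) powr (1 / q - 1)"
      using b[OF i] assms by (cases "b i = 0") (auto simp: powr_powr algebra_simps simp flip: powr_add)
    ultimately show ?thesis
      by (metis mult_left_mono powr_ge_zero)
  qed
  then have "(\<Sum>i\<in>I. b i) \<le> (\<Sum>i\<in>I. b i powr q * E powr (1 / q - 1))"
    by (rule sum_mono)
  also have "\<dots> \<le> E * E powr (1 / q - 1)"
    using E by (simp add: mult_right_mono flip: sum_distrib_right)
  also have "\<dots> = E powr (1 / q)"
    using E0 by (cases "E = 0") (auto simp: powr_diff)
  finally show ?thesis .
qed

section \<open>Riemann sums with a moving starting point\<close>

lemma integral_le_riemann_sum:
  fixes \<psi> :: "real \<Rightarrow> real"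
  assumes "0 \<le> \<theta>" "continuous_on UNIV \<psi>"
    and "\<And>x y. x \<in> {b..b + real n * \<theta>} \<Longrightarrow> y \<in> {b..b + real n * \<theta>} \<Longrightarrow> \<bar>x - y\<bar> \<le> \<theta> \<Longrightarrow> \<psi> x \<le> \<psi> y + \<eta>"
  shows "integral {b..b + real n * \<theta>} \<psi> \<le> \<theta> * (\<Sum>j<n. \<psi> (b + real j * \<theta>) + \<eta>)"
  using assms(3)
proof (induction n)
  case (Suc n)
  define c where "c = b + real n * \<theta>"
  have int: "\<psi> integrable_on {u..v}" for u v
    using assms by (intro integrable_continuous_real) (auto intro: continuous_on_subset)
  have c: "b \<le> c" "c \<le> c + \<theta>" "b + real (Suc n) * \<theta> = c + \<theta>"
    using assms(1) by (auto simp: c_def algebra_simps)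
  have "integral {b..c + \<theta>} \<psi> = integral {b..c} \<psi> + integral {c..c + \<theta>} \<psi>"
    using c int by (intro Henstock_Kurzweil_Integration.integral_combine[symmetric]) auto
  also have "integral {b..c} \<psi> \<le> \<theta> * (\<Sum>j<n. \<psi> (b + real j * \<theta>) + \<eta>)"
    unfolding c_def using Suc.prems c by (intro Suc.IH) (auto simp: c_def)
  also have "integral {c..c + \<theta>} \<psi> \<le> integral {c..c + \<theta>} (\<lambda>_. \<psi> c + \<eta>)"
    using int c by (intro integral_le) (auto intro!: Suc.prems)
  also have "\<dots> = \<theta> * (\<psi> c + \<eta>)"
    using assms(1) by simp
  finally show ?case
    using c by (simp add: c_def algebra_simps)
qed auto

text \<open>The sampled window \<open>{r - l..r + l}\<close> contains \<open>{0..l}\<close> for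
  every r in \<open>{0..l}\<close>, so it sees the whole integral. All windows lie in
  \<open>{- l..2 * l}\<close>, where uniform continuity makes the choice of n independent of
  r.\<close>

lemma eventually_riemann_mean_ge:
  fixes \<psi> :: "real \<Rightarrow> real"
  assumes cont: "continuous_on UNIV \<psi>" and nonneg: "\<And>x. 0 \<le> \<psi> x" and l: "0 < l" and \<eta>: "0 < \<eta>"
  shows "\<forall>\<^sub>F n in sequentially. \<forall>r\<in>{0..l}.
    integral {0..l} \<psi> / (2 * l) - \<eta> \<le> (\<Sum>j<n. \<psi> (r - l + real j * (2 * l / real n))) / real n"
proof -
  have "uniformly_continuous_on {- l..2 * l} \<psi>"
    by (intro compact_uniformly_continuous continuous_on_subset[OF cont]) auto
  then obtain d where d: "d > 0"
    "\<And>x y. x \<in> {- l..2 * l} \<Longrightarrow> y \<in> {- l..2 * l} \<Longrightarrow> \<bar>x - y\<bar> < d \<Longrightarrow> \<bar>\<psi> x - \<psi> y\<bar> < \<eta>"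
    using \<eta> unfolding uniformly_continuous_on_def dist_real_def by metis
  have "(\<lambda>n. 2 * l / real n) \<longlonglongrightarrow> 0" by (rule lim_const_over_n)
  then have "\<forall>\<^sub>F n in sequentially. 2 * l / real n < d"
    using d by (intro order_tendstoD)
  moreover have "\<forall>\<^sub>F n in sequentially. n > (0::nat)"
    by (rule eventually_gt_at_top)
  ultimately show ?thesis
  proof eventually_elim
    case (elim n)
    show ?case
    proof
      fix r assume r: "r \<in> {0..l}"
      define \<theta> where "\<theta> = 2 * l / real n"
      have n\<theta>: "real n * \<theta> = 2 * l" "\<theta> > 0" using elim l by (auto simp: \<theta>_def)
      have int: "\<psi> integrable_on {u..v}" for u v
        using cont by (intro integrable_continuous_real) (auto intro: continuous_on_subset)
      have "integral {0..l} \<psi> \<le> integral {r - l..r - l + real n * \<theta>} \<psi>"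
        using r n\<theta> nonneg by (intro integral_subset_le int) auto
      also have "\<dots> \<le> \<theta> * (\<Sum>j<n. \<psi> (r - l + real j * \<theta>) + \<eta>)"
      proof (rule integral_le_riemann_sum[OF _ cont])
        fix x y assume "x \<in> {r - l..r - l + real n * \<theta>}" "y \<in> {r - l..r - l + real n * \<theta>}" "\<bar>x - y\<bar> \<le> \<theta>"
        then have "\<bar>\<psi> x - \<psi> y\<bar> < \<eta>"
          using elim r n\<theta> by (intro d) (auto simp: \<theta>_def)
        then show "\<psi> x \<le> \<psi> y + \<eta>" by linarith
      qed (use n\<theta> in auto)
      finally have "integral {0..l} \<psi> \<le> 2 * l / real n * (\<Sum>j<n. \<psi> (r - l + real j * \<theta>)) + 2 * l * \<eta>"
        using elim by (simp add: sum.distrib \<theta>_def algebra_simps)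
      then show "integral {0..l} \<psi> / (2 * l) - \<eta> \<le> (\<Sum>j<n. \<psi> (r - l + real j * (2 * l / real n))) / real n"
        using l by (simp add: \<theta>_def field_simps)
    qed
  qed
qed

section \<open>Characters and the fibres of finite Gabor sums\<close>

definition character :: "real \<Rightarrow> real \<Rightarrow> complex" where
  "character s x = exp (2 * of_real pi * \<i> * of_real (s * x))"

lemma norm_character [simp]: "cmod (character s x) = 1"
  by (simp add: character_def norm_exp_eq_Re)

lemma character_add: "character s (x + y) = character s x * character s y"
  by (simp add: character_def algebra_simps flip: exp_add)

lemma continuous_on_character: "continuous_on A (character s)"
  unfolding character_def by (intro continuous_intros)

lemma gabor_character: "gabor g t s x = character s x * g (x - t)"
  by (simp add: gabor_def character_def)

text \<open>The trigonometric polynomial \<open>F\<^sub>t\<close> of the overview for a finite index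
  set \<open>F\<close>. The condition stands inside the sum over all of \<open>F\<close>, the form
  in which a multiplier supported on one fibre produces it.\<close>

definition fiber :: "(real \<times> real) set \<Rightarrow> (real \<times> real \<Rightarrow> complex) \<Rightarrow> real \<Rightarrow> real \<Rightarrow> complex" where
  "fiber F c \<tau> x = (\<Sum>i\<in>F. if fst i = \<tau> then c i * character (snd i) x else 0)"

lemma continuous_on_fiber: "continuous_on A (fiber F c \<tau>)"
proof -
  have "continuous_on A (\<lambda>x. if fst i = \<tau> then c i * character (snd i) x else 0)" for i
    by (cases "fst i = \<tau>") (auto intro!: continuous_intros continuous_on_character)
  then show ?thesis
    unfolding fiber_def by (intro continuous_on_sum)
qed

lemma borel_measurable_fiber [measurable]: "fiber F c \<tau> \<in> borel_measurable borel"
  by (intro borel_measurable_continuous_onI continuous_on_fiber)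

lemma gabor_sum_eq_fiber_sum:
  assumes "finite F"
  shows "(\<Sum>i\<in>F. c i * gabor g (fst i) (snd i) x) = (\<Sum>\<tau>\<in>fst ` F. fiber F c \<tau> x * g (x - \<tau>))"
proof -
  have "(\<Sum>\<tau>\<in>fst ` F. fiber F c \<tau> x * g (x - \<tau>))
    = (\<Sum>i\<in>F. \<Sum>\<tau>\<in>fst ` F. if \<tau> = fst i then c i * character (snd i) x * g (x - \<tau>) else 0)"
    unfolding fiber_def sum_distrib_right
    by (subst sum.swap) (intro sum.cong, auto)
  also have "\<dots> = (\<Sum>i\<in>F. c i * gabor g (fst i) (snd i) x)"
    using assms by (intro sum.cong refl) (simp add: gabor_character mult.assoc)
  finally show ?thesis ..
qed

text \<open>Characters are multiplicative, so translating a fibre multiplies its coefficients by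
  unimodular numbers. Translates of fibres are thus multiplier sums, which is what makes the square
  function bound applicable to them.\<close>

lemma fiber_translate:
  "(\<Sum>i\<in>F. (if fst i = \<tau> then character (snd i) y else 0) * (c i * gabor g (fst i) (snd i) x))
    = fiber F c \<tau> (x + y) * g (x - \<tau>)"
  unfolding fiber_def sum_distrib_right
  by (intro sum.cong) (auto simp: gabor_character character_add)

lemma nn_integral_translate:
  fixes f :: "real \<Rightarrow> ennreal"
  assumes "f \<in> borel_measurable borel"
  shows "(\<integral>\<^sup>+x. f (x - \<tau>) \<partial>lborel) = (\<integral>\<^sup>+x. f x \<partial>lborel)"
  using nn_integral_real_affine[OF assms, of 1 "- \<tau>"] by (simp add: algebra_simps)

text \<open>The square function inequality is applied to the multipliers selecting one \<open>\<tau>\<close> and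
  translating its fibre by \<open>y j - \<tau>\<close>; on the disjoint intervals \<open>\<tau> + {a..a + l}\<close> only one fibre
  survives, and the mean over the sampling points \<open>y j\<close> is a Riemann sum.\<close>

lemma fiber_bound_approx:
  fixes g :: "real \<Rightarrow> complex" and p K l a \<eta> :: real
  assumes F: "finite F" and [measurable]: "g \<in> borel_measurable borel"
    and p: "1 \<le> p" "p \<le> 2" and K: "0 \<le> K" and l: "0 < l" and \<eta>: "0 < \<eta>"
    and sep: "\<And>t t'. t \<in> fst ` F \<Longrightarrow> t' \<in> fst ` F \<Longrightarrow> t \<noteq> t' \<Longrightarrow> l < \<bar>t - t'\<bar>"
    and mult: "multiplier_bound lborel F (\<lambda>i x. c i * gabor g (fst i) (snd i) x) p K"
  shows "(\<Sum>\<tau>\<in>fst ` F. ennreal (max 0 (integral {0..l} (\<lambda>x. (cmod (fiber F c \<tau> x))\<^sup>2) / (2 * l) - \<eta>) powr (p / 2)))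
      * (\<integral>\<^sup>+z. ennreal (indicator {a..a + l} z * cmod (g z) powr p) \<partial>lborel)
    \<le> ennreal (64 * 256 powr p * K)"
proof -
  define T where "T = fst ` F"
  have T: "finite T" using F by (simp add: T_def)
  \<comment> \<open>The loss \<open>\<eta>\<close> pays for the error of the Riemann sum; the
    maximum with 0 keeps the base of the later power nonnegative.\<close>
  define m where "m \<tau> = max 0 (integral {0..l} (\<lambda>x. (cmod (fiber F c \<tau> x))\<^sup>2) / (2 * l) - \<eta>)" for \<tau>
  define H where "H \<tau> z = indicator {a..a + l} z * cmod (g z) powr p * m \<tau> powr (p / 2)" for \<tau> z
  have [measurable]: "H \<tau> \<in> borel_measurable borel" for \<tau>
    unfolding H_def by measurable
  have ev: "\<forall>\<^sub>F n in sequentially. \<forall>r\<in>{0..l}. integral {0..l} (\<lambda>x. (cmod (fiber F c \<tau> x))\<^sup>2) / (2 * l) - \<eta>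
      \<le> (\<Sum>j<n. (cmod (fiber F c \<tau> (r - l + real j * (2 * l / real n))))\<^sup>2) / real n" for \<tau>
    by (rule eventually_riemann_mean_ge) (auto intro!: continuous_intros continuous_on_fiber l \<eta>)
  have "\<forall>\<^sub>F n in sequentially. (\<forall>\<tau>\<in>T. \<forall>r\<in>{0..l}. integral {0..l} (\<lambda>x. (cmod (fiber F c \<tau> x))\<^sup>2) / (2 * l) - \<eta>
      \<le> (\<Sum>j<n. (cmod (fiber F c \<tau> (r - l + real j * (2 * l / real n))))\<^sup>2) / real n) \<and> n > 0"
    by (intro eventually_conj eventually_gt_at_top, rule eventually_ball_finite[OF T], rule ballI, rule ev)
  from eventually_happens'[OF sequentially_bot this]
  obtain n where n: "n > 0" and mean: "\<forall>\<tau>\<in>T. \<forall>r\<in>{0..l}.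
      integral {0..l} (\<lambda>x. (cmod (fiber F c \<tau> x))\<^sup>2) / (2 * l) - \<eta>
      \<le> (\<Sum>j<n. (cmod (fiber F c \<tau> (r - l + real j * (2 * l / real n))))\<^sup>2) / real n"
    by (elim exE conjE)
  \<comment> \<open>Chosen so that for r = x - \<open>\<tau>\<close> - a in \<open>{0..l}\<close>
    the arguments \<open>x - \<tau> + y j\<close> are exactly the sampling points
    \<open>r - l + real j * (2 * l / real n)\<close>.\<close>
  define y where "y j = real j * (2 * l / real n) - a - l" for j :: nat
  \<comment> \<open>For a given \<open>i\<close> only the pairs with \<open>\<tau> = fst i\<close>
    count; there are n of them, each with squared modulus 1/n, so the square sum is exactly 1
    however many fibres there are.\<close>
  define X where "X = (\<lambda>(\<tau>, j) i. (if fst i = \<tau> then character (snd i) (y j - \<tau>) else 0) / of_real (sqrt (real n)))"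
  define Q where "Q x = (\<Sum>\<tau>\<in>T. (\<Sum>j<n. (cmod (fiber F c \<tau> (x - \<tau> + y j)))\<^sup>2) / real n * (cmod (g (x - \<tau>)))\<^sup>2)" for x
  have Q: "(\<Sum>k\<in>T \<times> {..<n}. (cmod (\<Sum>i\<in>F. X k i * (c i * gabor g (fst i) (snd i) x)))\<^sup>2) = Q x" for x
  proof -
    have "(\<Sum>i\<in>F. X (\<tau>, j) i * (c i * gabor g (fst i) (snd i) x))
      = fiber F c \<tau> (x + (y j - \<tau>)) * g (x - \<tau>) / of_real (sqrt (real n))" for \<tau> j
      unfolding X_def by (simp add: sum_divide_distrib flip: fiber_translate)
    then show ?thesis
      unfolding Q_def sum.cartesian_product' sum_divide_distrib sum_distrib_right
      using n by (intro sum.cong) (simp_all add: norm_divide norm_mult power_divide power_mult_distrib algebra_simps)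
  qed
  have "(\<integral>\<^sup>+x. ennreal (Q x powr (p / 2)) \<partial>lborel) \<le> ennreal (64 * 256 powr p * K)"
    unfolding Q[symmetric]
  proof (rule square_function_boundD)
    show "square_function_bound lborel F (\<lambda>i x. c i * gabor g (fst i) (snd i) x) p (64 * 256 powr p * K)"
      by (intro square_function_bound_of_multiplier_bound F p K mult) (simp add: gabor_def)
    show "finite (T \<times> {..<n})" using T by simp
    fix i assume "i \<in> F"
    then have i: "fst i \<in> T" by (simp add: T_def)
    have "(\<Sum>k\<in>T \<times> {..<n}. (cmod (X k i))\<^sup>2) = (\<Sum>\<tau>\<in>T. \<Sum>j<n. (cmod (X (\<tau>, j) i))\<^sup>2)"
      by (simp add: sum.cartesian_product')
    also have "\<dots> = (\<Sum>\<tau>\<in>T. if \<tau> = fst i then 1 else 0)"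
      using n by (intro sum.cong) (auto simp: X_def norm_divide power_divide)
    also have "\<dots> = 1" using T i by simp
    finally show "(\<Sum>k\<in>T \<times> {..<n}. (cmod (X k i))\<^sup>2) \<le> 1" by simp
  qed
  moreover have "(\<Sum>\<tau>\<in>T. H \<tau> (x - \<tau>)) \<le> Q x powr (p / 2)" for x
  proof (cases "\<exists>\<tau>\<in>T. x - \<tau> \<in> {a..a + l}")
    case True
    then obtain \<tau> where \<tau>: "\<tau> \<in> T" "x - \<tau> \<in> {a..a + l}" by auto
    have "H t (x - t) = 0" if "t \<in> T - {\<tau>}" for t
      using sep[of t \<tau>] that \<tau> by (auto simp: H_def indicator_def T_def)
    then have "(\<Sum>t\<in>T. H t (x - t)) = H \<tau> (x - \<tau>)"
      using T \<tau> by (simp add: sum.remove)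
    also have "\<dots> = (m \<tau> * (cmod (g (x - \<tau>)))\<^sup>2) powr (p / 2)"
      using \<tau> by (simp add: H_def powr_mult powr_powr m_def flip: powr_numeral)
    also have "\<dots> \<le> Q x powr (p / 2)"
    proof (intro powr_mono2)
      have "m \<tau> \<le> (\<Sum>j<n. (cmod (fiber F c \<tau> (x - \<tau> + y j)))\<^sup>2) / real n"
        using mean[rule_format, of \<tau> "x - \<tau> - a"] \<tau> by (auto simp: m_def y_def algebra_simps intro!: divide_nonneg_nonneg sum_nonneg)
      then have "m \<tau> * (cmod (g (x - \<tau>)))\<^sup>2 \<le> (\<Sum>j<n. (cmod (fiber F c \<tau> (x - \<tau> + y j)))\<^sup>2) / real n * (cmod (g (x - \<tau>)))\<^sup>2"
        by (intro mult_right_mono) auto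
      also have "\<dots> \<le> Q x"
        unfolding Q_def using T \<tau>
        by (intro member_le_sum) (auto intro!: mult_nonneg_nonneg divide_nonneg_nonneg sum_nonneg)
      finally show "m \<tau> * (cmod (g (x - \<tau>)))\<^sup>2 \<le> Q x" .
    qed (use p in \<open>auto simp: m_def\<close>)
    finally show ?thesis .
  next
    case False
    then have "(\<Sum>\<tau>\<in>T. H \<tau> (x - \<tau>)) = 0"
      by (intro sum.neutral) (auto simp: H_def indicator_def)
    then show ?thesis by simp
  qed
  then have "(\<integral>\<^sup>+x. (\<Sum>\<tau>\<in>T. ennreal (H \<tau> (x - \<tau>))) \<partial>lborel) \<le> (\<integral>\<^sup>+x. ennreal (Q x powr (p / 2)) \<partial>lborel)"
    by (intro nn_integral_mono) (simp add: H_def sum_ennreal ennreal_leI)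
  moreover have "(\<integral>\<^sup>+x. (\<Sum>\<tau>\<in>T. ennreal (H \<tau> (x - \<tau>))) \<partial>lborel)
    = (\<Sum>\<tau>\<in>T. ennreal (m \<tau> powr (p / 2))) * (\<integral>\<^sup>+z. ennreal (indicator {a..a + l} z * cmod (g z) powr p) \<partial>lborel)"
  proof -
    have "(\<integral>\<^sup>+x. (\<Sum>\<tau>\<in>T. ennreal (H \<tau> (x - \<tau>))) \<partial>lborel) = (\<Sum>\<tau>\<in>T. \<integral>\<^sup>+z. ennreal (H \<tau> z) \<partial>lborel)"
      by (simp add: nn_integral_sum nn_integral_translate[of "\<lambda>z. ennreal (H _ z)"] del: sum_ennreal)
    also have "\<dots> = (\<Sum>\<tau>\<in>T. (\<integral>\<^sup>+z. ennreal (indicator {a..a + l} z * cmod (g z) powr p) \<partial>lborel) * ennreal (m \<tau> powr (p / 2)))"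
      by (intro sum.cong refl) (simp add: H_def ennreal_mult nn_integral_multc[symmetric])
    finally show ?thesis by (simp add: sum_distrib_right mult.commute del: sum_ennreal)
  qed
  ultimately show ?thesis
    unfolding m_def T_def by simp
qed

text \<open>After division by the mass \<open>G\<close> of g on the window and the limit
  \<open>\<eta>\<close> to 0, the mean squares of the fibres are bounded in
  \<open>\<ell>\<^sup>q\<close> with q = p/2. Since q is at most 1, this bounds their sum.\<close>

lemma fiber_bound:
  fixes g :: "real \<Rightarrow> complex" and p K l a G :: real
  assumes F: "finite F" and g: "g \<in> borel_measurable borel"
    and p: "1 \<le> p" "p \<le> 2" and K: "0 \<le> K" and l: "0 < l"
    and sep: "\<And>t t'. t \<in> fst ` F \<Longrightarrow> t' \<in> fst ` F \<Longrightarrow> t \<noteq> t' \<Longrightarrow> l < \<bar>t - t'\<bar>"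
    and mult: "multiplier_bound lborel F (\<lambda>i x. c i * gabor g (fst i) (snd i) x) p K"
    and G: "0 < G" "ennreal G \<le> (\<integral>\<^sup>+z. ennreal (indicator {a..a + l} z * cmod (g z) powr p) \<partial>lborel)"
  shows "(\<Sum>\<tau>\<in>fst ` F. integral {0..l} (\<lambda>x. (cmod (fiber F c \<tau> x))\<^sup>2))
    \<le> 2 * l * (64 * 256 powr p * K / G) powr (2 / p)"
proof -
  define b where "b \<tau> = integral {0..l} (\<lambda>x. (cmod (fiber F c \<tau> x))\<^sup>2) / (2 * l)" for \<tau>
  have b: "b \<tau> \<ge> 0" for \<tau>
    unfolding b_def using l
    by (intro divide_nonneg_nonneg integral_nonneg integrable_continuous_real)
      (auto intro!: continuous_intros continuous_on_fiber)
  define D where "D = 64 * 256 powr p * K"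
  have D: "D \<ge> 0" using K by (simp add: D_def)
  have "(\<Sum>\<tau>\<in>fst ` F. max 0 (b \<tau> - \<eta>) powr (p / 2)) \<le> D / G" if \<eta>: "\<eta> > 0" for \<eta>
  proof -
    define s where "s = (\<Sum>\<tau>\<in>fst ` F. max 0 (b \<tau> - \<eta>) powr (p / 2))"
    have s: "s \<ge> 0" by (simp add: s_def sum_nonneg)
    have "ennreal (s * G) = ennreal s * ennreal G"
      using s G by (simp add: ennreal_mult)
    also have "\<dots> \<le> ennreal s * (\<integral>\<^sup>+z. ennreal (indicator {a..a + l} z * cmod (g z) powr p) \<partial>lborel)"
      using G by (intro mult_left_mono) auto
    also have "\<dots> \<le> ennreal D"
      using fiber_bound_approx[OF F g p K l \<eta> sep mult, of a] by (simp add: s_def b_def D_def)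
    finally have "s * G \<le> D" using D by simp
    then show ?thesis using G by (simp add: s_def field_simps)
  qed
  then have "\<forall>\<^sub>F \<eta> in at_right 0. (\<Sum>\<tau>\<in>fst ` F. max 0 (b \<tau> - \<eta>) powr (p / 2)) \<le> D / G"
    by (auto simp: eventually_at_filter)
  moreover have "((\<lambda>\<eta>. \<Sum>\<tau>\<in>fst ` F. max 0 (b \<tau> - \<eta>) powr (p / 2)) \<longlongrightarrow> (\<Sum>\<tau>\<in>fst ` F. max 0 (b \<tau> - 0) powr (p / 2))) (at_right 0)"
    using p by (intro tendsto_sum tendsto_powr' tendsto_max tendsto_diff tendsto_const tendsto_ident_at) auto
  ultimately have "(\<Sum>\<tau>\<in>fst ` F. max 0 (b \<tau> - 0) powr (p / 2)) \<le> D / G"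
    by (intro tendsto_upperbound) auto
  then have "(\<Sum>\<tau>\<in>fst ` F. b \<tau>) \<le> (D / G) powr (1 / (p / 2))"
    using F p b by (intro sum_le_powr_of_sum_powr_le) (auto simp: max_def)
  then show ?thesis
    using l by (simp add: b_def D_def field_simps flip: sum_divide_distrib)
qed

text \<open>Cauchy-Schwarz over \<open>\<tau>\<close>. On \<open>A\<close> the translates of g are
  bounded in \<open>\<ell>\<^sup>p\<close>, hence in \<open>\<ell>\<^sup>2\<close>; the other
  factor, the square sum of the fibres, integrates to at most \<open>W\<close>.\<close>

lemma gabor_sum_square_integral_bound:
  fixes g :: "real \<Rightarrow> complex" and p W l N :: real
  assumes F: "finite F" and [measurable]: "g \<in> borel_measurable borel"
    and p: "0 < p" "p \<le> 2" and l: "0 < l"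
    and W: "(\<Sum>\<tau>\<in>fst ` F. integral {0..l} (\<lambda>x. (cmod (fiber F c \<tau> x))\<^sup>2)) \<le> W"
    and A: "A \<subseteq> {0..l}" "\<And>x. x \<in> A \<Longrightarrow> (\<Sum>\<tau>\<in>fst ` F. cmod (g (x - \<tau>)) powr p) \<le> N"
  shows "(\<integral>\<^sup>+x. ennreal (indicator A x * (cmod (\<Sum>i\<in>F. c i * gabor g (fst i) (snd i) x))\<^sup>2) \<partial>lborel)
    \<le> ennreal (N powr (2 / p) * W)"
proof -
  define h where "h x = (\<Sum>\<tau>\<in>fst ` F. (cmod (fiber F c \<tau> x))\<^sup>2)" for x
  have h0: "h x \<ge> 0" for x by (simp add: h_def sum_nonneg)
  have [measurable]: "h \<in> borel_measurable borel"
    unfolding h_def by measurable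
  have le: "indicator A x * (cmod (\<Sum>i\<in>F. c i * gabor g (fst i) (snd i) x))\<^sup>2
    \<le> N powr (2 / p) * (indicator {0..l} x * h x)" for x
  proof (cases "x \<in> A")
    case True
    have "(\<Sum>\<tau>\<in>fst ` F. ((cmod (g (x - \<tau>)))\<^sup>2) powr (p / 2)) \<le> N"
      using A(2)[OF True] by (simp add: powr_powr flip: powr_numeral)
    then have g2: "(\<Sum>\<tau>\<in>fst ` F. (cmod (g (x - \<tau>)))\<^sup>2) \<le> N powr (1 / (p / 2))"
      using F p by (intro sum_le_powr_of_sum_powr_le) auto
    have "cmod (\<Sum>i\<in>F. c i * gabor g (fst i) (snd i) x)
      \<le> (\<Sum>\<tau>\<in>fst ` F. cmod (fiber F c \<tau> x) * cmod (g (x - \<tau>)))"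
      unfolding gabor_sum_eq_fiber_sum[OF F] by (rule sum_norm_le) (simp add: norm_mult)
    then have "(cmod (\<Sum>i\<in>F. c i * gabor g (fst i) (snd i) x))\<^sup>2
      \<le> (\<Sum>\<tau>\<in>fst ` F. cmod (fiber F c \<tau> x) * cmod (g (x - \<tau>)))\<^sup>2"
      by (intro power_mono) auto
    also have "\<dots> \<le> h x * (\<Sum>\<tau>\<in>fst ` F. (cmod (g (x - \<tau>)))\<^sup>2)"
      unfolding h_def by (rule Cauchy_Schwarz_ineq_sum)
    also have "\<dots> \<le> h x * N powr (2 / p)"
      using g2 h0 by (intro mult_left_mono) auto
    finally show ?thesis using True A by (auto simp: mult.commute)
  qed (simp add: h0)
  have "(h has_integral (\<Sum>\<tau>\<in>fst ` F. integral {0..l} (\<lambda>x. (cmod (fiber F c \<tau> x))\<^sup>2))) {0..l}"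
    unfolding h_def using F
    by (intro has_integral_sum integrable_integral integrable_continuous_real finite_imageI)
      (auto intro!: continuous_intros continuous_on_fiber)
  then have "((\<lambda>x. if x \<in> {0..l} then h x else 0) has_integral (\<Sum>\<tau>\<in>fst ` F. integral {0..l} (\<lambda>x. (cmod (fiber F c \<tau> x))\<^sup>2))) UNIV"
    by (simp only: has_integral_restrict_UNIV)
  then have int: "(\<integral>\<^sup>+x. ennreal (indicator {0..l} x * h x) \<partial>lborel)
    = ennreal (\<Sum>\<tau>\<in>fst ` F. integral {0..l} (\<lambda>x. (cmod (fiber F c \<tau> x))\<^sup>2))"
    unfolding indicator_times_eq_if
    by (rule nn_integral_has_integral_lborel[rotated 2]) (use h0 in auto)
  have "(\<integral>\<^sup>+x. ennreal (indicator A x * (cmod (\<Sum>i\<in>F. c i * gabor g (fst i) (snd i) x))\<^sup>2) \<partial>lborel)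
    \<le> (\<integral>\<^sup>+x. ennreal (N powr (2 / p)) * ennreal (indicator {0..l} x * h x) \<partial>lborel)"
    using le h0 by (intro nn_integral_mono) (simp add: ennreal_leI flip: ennreal_mult)
  also have "\<dots> = ennreal (N powr (2 / p)) * (\<integral>\<^sup>+x. ennreal (indicator {0..l} x * h x) \<partial>lborel)"
    by (intro nn_integral_cmult) simp
  also have "\<dots> \<le> ennreal (N powr (2 / p)) * ennreal W"
    unfolding int using W by (intro mult_left_mono ennreal_leI) auto
  also have "\<dots> = ennreal (N powr (2 / p) * W)"
    by (simp add: ennreal_mult')
  finally show ?thesis .
qed

subsection \<open>Bounded translates and test functions\<close>

text \<open>The intervals \<open>{0..l}\<close> shifted by \<open>- \<tau>\<close> are disjoint, so
  the sum of the translates of \<open>|g|\<^sup>p\<close> over \<open>T\<close> has integral over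
  \<open>{0..l}\<close> at most that of \<open>|g|\<^sup>p\<close> over the line. It is finite
  almost everywhere, and one of its sublevel sets has positive measure.\<close>

lemma exists_set_bounded_translates:
  fixes g :: "real \<Rightarrow> complex" and p l :: real
  assumes g: "g \<in> Lp_space p" and T: "countable T" and l: "0 < l"
    and sep: "\<And>t t'. t \<in> T \<Longrightarrow> t' \<in> T \<Longrightarrow> t \<noteq> t' \<Longrightarrow> l < \<bar>t - t'\<bar>"
  obtains A and N :: real where "A \<in> sets borel" "A \<subseteq> {0..l}" "0 < measure lborel A"
    "\<And>F x. finite F \<Longrightarrow> F \<subseteq> T \<Longrightarrow> x \<in> A \<Longrightarrow> (\<Sum>\<tau>\<in>F. cmod (g (x - \<tau>)) powr p) \<le> N"
proof -
  have [measurable]: "g \<in> borel_measurable borel" using g by (rule Lp_space_measurable)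
  define k where "k x \<tau> = ennreal (indicator {0..l} x * cmod (g (x - \<tau>)) powr p)" for x \<tau>
  have [measurable]: "(\<lambda>x. k x \<tau>) \<in> borel_measurable borel" for \<tau>
    unfolding k_def by measurable
  \<comment> \<open>The sum over the translations is written as an integral against counting
    measure, so that measurability and the exchange with the integral over x are instances of
    Tonelli's theorem.\<close>
  define h where "h x = (\<integral>\<^sup>+\<tau>. k x \<tau> \<partial>count_space T)" for x
  have h_meas [measurable]: "h \<in> borel_measurable borel"
  proof -
    interpret sigma_finite_measure "count_space T"
      using T by (rule sigma_finite_measure_count_space_countable)
    have "(\<lambda>(\<tau>, x). k x \<tau>) \<in> borel_measurable (count_space T \<Otimes>\<^sub>M borel)"
      using T by (rule measurable_pair_measure_countable1) simp
    from measurable_pair_swap[OF this] show ?thesis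
      unfolding h_def by (intro borel_measurable_nn_integral) simp
  qed
  have at_most_one: "(\<integral>\<^sup>+\<tau>. k (z + \<tau>) \<tau> \<partial>count_space T) \<le> ennreal (cmod (g z) powr p)" for z
  proof (cases "\<exists>\<tau>\<in>T. z + \<tau> \<in> {0..l}")
    case True
    then obtain \<tau> where \<tau>: "\<tau> \<in> T" "z + \<tau> \<in> {0..l}" by auto
    have "k (z + t) t = 0" if "t \<in> T" "t \<notin> {\<tau>}" for t
      using sep[of t \<tau>] that \<tau> by (auto simp: k_def indicator_def)
    then have "(\<integral>\<^sup>+t. k (z + t) t \<partial>count_space T) = (\<Sum>t\<in>{\<tau>}. k (z + t) t)"
      using \<tau> by (intro nn_integral_count_space') auto
    also have "\<dots> \<le> ennreal (cmod (g z) powr p)"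
      using \<tau> by (simp add: k_def)
    finally show ?thesis .
  next
    case False
    then have "(\<integral>\<^sup>+\<tau>. k (z + \<tau>) \<tau> \<partial>count_space T) = (\<integral>\<^sup>+\<tau>. 0 \<partial>count_space T)"
      by (intro nn_integral_cong) (auto simp: k_def indicator_def)
    then show ?thesis by simp
  qed
  have "(\<integral>\<^sup>+x. h x \<partial>lborel) = (\<integral>\<^sup>+\<tau>. \<integral>\<^sup>+x. k x \<tau> \<partial>lborel \<partial>count_space T)"
    unfolding h_def using T by (intro nn_integral_count_space_nn_integral) auto
  also have "\<dots> = (\<integral>\<^sup>+\<tau>. \<integral>\<^sup>+z. k (z + \<tau>) \<tau> \<partial>lborel \<partial>count_space T)"
    by (subst nn_integral_translate[of "\<lambda>x. k x \<tau>" "- \<tau>" for \<tau>, symmetric]) simp_all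
  also have "\<dots> = (\<integral>\<^sup>+z. \<integral>\<^sup>+\<tau>. k (z + \<tau>) \<tau> \<partial>count_space T \<partial>lborel)"
    using T by (intro nn_integral_count_space_nn_integral[symmetric]) auto
  also have "\<dots> \<le> (\<integral>\<^sup>+z. ennreal (cmod (g z) powr p) \<partial>lborel)"
    by (intro nn_integral_mono at_most_one)
  also have "\<dots> < \<infinity>" using g by (simp add: Lp_space_iff)
  finally have "AE x in lborel. h x \<noteq> \<infinity>"
    by (intro nn_integral_PInf_AE) auto
  define A where "A n = {x \<in> {0..l}. h x \<le> of_nat n}" for n :: nat
  have A [measurable]: "A n \<in> sets borel" for n
    unfolding A_def by measurable
  have "\<exists>n. emeasure lborel (A n) \<noteq> 0"
  proof (rule ccontr)
    assume "\<nexists>n. emeasure lborel (A n) \<noteq> 0"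
    then have "AE x in lborel. x \<notin> A n" for n
      by (intro AE_not_in) (auto simp: null_sets_def)
    then have "AE x in lborel. \<forall>n. x \<notin> A n" by (simp add: AE_all_countable)
    with \<open>AE x in lborel. h x \<noteq> \<infinity>\<close> have "AE x in lborel. x \<notin> {0..l}"
    proof eventually_elim
      case (elim x)
      then show ?case
        using ennreal_Ex_less_of_nat[of "h x"] by (auto simp: A_def top.not_eq_extremum dest: less_imp_le)
    qed
    then have "emeasure lborel {0..l} = 0"
      by (subst (asm) AE_iff_measurable[OF _ refl]) (auto simp: atLeastAtMost_def atLeast_def atMost_def Int_def)
    then show False using l by simp
  qed
  then obtain n where n: "emeasure lborel (A n) \<noteq> 0" by auto
  have "emeasure lborel (A n) \<le> emeasure lborel {0..l}"
    by (intro emeasure_mono) (auto simp: A_def)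
  then have "emeasure lborel (A n) < \<infinity>" using l by (auto intro: le_less_trans)
  then have "0 < measure lborel (A n)"
    using n by (simp add: measure_def enn2real_positive_iff zero_less_iff_neq_zero top.not_eq_extremum)
  moreover have "(\<Sum>\<tau>\<in>F. cmod (g (x - \<tau>)) powr p) \<le> real n"
    if F: "finite F" "F \<subseteq> T" and x: "x \<in> A n" for F x
  proof -
    have "ennreal (\<Sum>\<tau>\<in>F. cmod (g (x - \<tau>)) powr p) = (\<Sum>\<tau>\<in>F. k x \<tau> * indicator F \<tau>)"
      using x by (simp add: k_def A_def sum_ennreal[symmetric] del: sum_ennreal)
    also have "\<dots> = (\<integral>\<^sup>+\<tau>. k x \<tau> * indicator F \<tau> \<partial>count_space T)"
      using F by (intro nn_integral_count_space'[symmetric]) auto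
    also have "\<dots> \<le> h x"
      unfolding h_def by (intro nn_integral_mono) (auto simp: indicator_def)
    also have "\<dots> \<le> of_nat n" using x by (simp add: A_def)
    also have "\<dots> = ennreal (real n)" by (simp add: ennreal_of_nat_eq_real_of_nat)
    finally show ?thesis by simp
  qed
  moreover have "A n \<subseteq> {0..l}" by (auto simp: A_def)
  ultimately show ?thesis
    using that[OF A] by blast
qed

text \<open>Countably many intervals of length \<open>l\<close> tile the line; if g vanished almost
  everywhere on each, it would do so on the whole line.\<close>

lemma exists_interval_mass:
  fixes g :: "real \<Rightarrow> complex" and p l :: real
  assumes [measurable]: "g \<in> borel_measurable borel" and l: "0 < l"
    and g: "(\<integral>\<^sup>+x. ennreal (cmod (g x) powr p) \<partial>lborel) \<noteq> 0"
  obtains a G where "0 < G"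
    "ennreal G \<le> (\<integral>\<^sup>+z. ennreal (indicator {a..a + l} z * cmod (g z) powr p) \<partial>lborel)"
proof -
  have "\<exists>a. (\<integral>\<^sup>+z. ennreal (indicator {a..a + l} z * cmod (g z) powr p) \<partial>lborel) \<noteq> 0"
  proof (rule ccontr)
    assume "\<nexists>a. (\<integral>\<^sup>+z. ennreal (indicator {a..a + l} z * cmod (g z) powr p) \<partial>lborel) \<noteq> 0"
    then have "AE z in lborel. ennreal (indicator {a..a + l} z * cmod (g z) powr p) = 0" for a
      by (subst nn_integral_0_iff_AE[symmetric]) auto
    then have "AE z in lborel. \<forall>k::int. ennreal (indicator {k * l..k * l + l} z * cmod (g z) powr p) = 0"
      unfolding AE_all_countable by (intro allI)
    then have "AE z in lborel. ennreal (cmod (g z) powr p) = 0"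
    proof eventually_elim
      case (elim z)
      have "z \<in> {\<lfloor>z / l\<rfloor> * l..\<lfloor>z / l\<rfloor> * l + l}"
        using l mult_right_mono[OF of_int_floor_le[of "z / l"], of l] floor_correct[of "z / l"]
        by (auto simp: field_simps)
      then show ?case using elim[rule_format, of "\<lfloor>z / l\<rfloor>"] by simp
    qed
    then show False
      using g by (subst (asm) nn_integral_0_iff_AE[symmetric]) auto
  qed
  then obtain a where a: "(\<integral>\<^sup>+z. ennreal (indicator {a..a + l} z * cmod (g z) powr p) \<partial>lborel) \<noteq> 0"
    by auto
  show ?thesis
  proof (cases "(\<integral>\<^sup>+z. ennreal (indicator {a..a + l} z * cmod (g z) powr p) \<partial>lborel)")
    case (real G)
    then show ?thesis using a by (intro that[of G a]) (auto simp: less_le)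
  next
    case top
    then show ?thesis by (intro that[of 1 a]) auto
  qed
qed

text \<open>With \<open>m x\<close> the measure of the part of \<open>A\<close> left of x, take
  \<open>m powr (- 1 / 2)\<close> on \<open>A\<close>. Since m carries Lebesgue measure on
  \<open>A\<close> to that on an interval from 0, the p-th power behaves like
  \<open>t powr (- p / 2)\<close>, integrable for p < 2, and the square like 1/t. Instead of a
  change of variables, \<open>A\<close> is cut at the levels \<open>\<alpha> / 4 ^ k\<close> of m;
  each piece contributes at least 3/4 to the square integral.\<close>

lemma exists_Lp_not_locally_L2:
  fixes p l :: real
  assumes A [measurable]: "A \<in> sets borel" and Al: "A \<subseteq> {0..l}" and pos: "0 < measure lborel A"
    and p: "0 < p" "p < 2"
  obtains f where "f \<in> Lp_space p"
    "\<And>n::nat. \<exists>N>0. ennreal (3 / 4 * real n)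
      \<le> (\<integral>\<^sup>+x. ennreal (indicator A x * (min (cmod (f x)) N)\<^sup>2) \<partial>lborel)"
proof -
  define \<alpha> where "\<alpha> = measure lborel A"
  have \<alpha>: "\<alpha> > 0" using pos by (simp add: \<alpha>_def)
  define m where "m x = measure lborel (A \<inter> {..x})" for x
  have fin: "A \<inter> S \<in> fmeasurable lborel" if "S \<in> sets borel" for S
  proof (rule fmeasurableI2[of "{0..l}"])
    show "A \<inter> S \<in> sets lborel" using that by simp
  qed (use Al in \<open>auto simp: fmeasurable_def emeasure_lborel_Icc_eq\<close>)
  have m_diff: "measure lborel (A \<inter> {x<..y}) = m y - m x" if "x \<le> y" for x y
  proof -
    have "A \<inter> {..y} = (A \<inter> {..x}) \<union> (A \<inter> {x<..y})" using that by auto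
    then have "m y = m x + measure lborel (A \<inter> {x<..y})"
      using fin[of "{..x}"] fin[of "{x<..y}"] unfolding m_def
      by (simp only:) (intro measure_Union, auto simp: fmeasurable_def)
    then show ?thesis by simp
  qed
  have m_mono: "m x \<le> m y" if "x \<le> y" for x y
    using m_diff[OF that] by (metis diff_ge_0_iff_ge measure_nonneg)
  have m_lip: "m y - m x \<le> y - x" if "x \<le> y" for x y
  proof -
    have "measure lborel (A \<inter> {x<..y}) \<le> measure lborel {x<..y}"
      using that by (intro measure_mono_fmeasurable) (auto simp: fmeasurable_def)
    then show ?thesis using m_diff[OF that] that by simp
  qed
  have m_cont: "continuous_on S m" for S
  proof -
    have "\<bar>m x - m y\<bar> \<le> \<bar>x - y\<bar>" for x y
      using m_mono[of x y] m_mono[of y x] m_lip[of x y] m_lip[of y x] by (cases "x \<le> y") auto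
    then have "1-lipschitz_on S m" by (intro lipschitz_onI) (auto simp: dist_real_def)
    then show ?thesis by (rule lipschitz_on_continuous_on)
  qed
  then have [measurable]: "m \<in> borel_measurable borel"
    by (intro borel_measurable_continuous_onI)
  have m0: "m 0 = 0"
  proof -
    have "m 0 \<le> measure lborel {0::real}"
      unfolding m_def using Al by (intro measure_mono_fmeasurable) (auto simp: fmeasurable_def)
    then show ?thesis using measure_nonneg[of lborel "A \<inter> {..0}"] by (simp add: m_def)
  qed
  have ml: "m l = \<alpha>"
    unfolding m_def \<alpha>_def using Al by (intro arg_cong[where f = "measure lborel"]) auto
  have "l \<ge> 0" using m_mono[of l 0] ml m0 \<alpha> by linarith
  \<comment> \<open>m may be constant on intervals, so a level does not determine its point; the
    point for k = 0 is pinned to \<open>l\<close> so that the pieces reach the right end of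
    \<open>A\<close>.\<close>
  have "\<exists>x. m x = \<alpha> / 4 ^ k \<and> (k = 0 \<longrightarrow> x = l)" for k :: nat
  proof (cases "k = 0")
    case False
    have "\<alpha> / 4 ^ k \<le> \<alpha>" using \<alpha> by (simp add: field_simps)
    then show ?thesis
      using IVT'[of m 0 "\<alpha> / 4 ^ k" l] m0 ml \<alpha> \<open>l \<ge> 0\<close> m_cont False by auto
  qed (use ml in auto)
  then obtain \<xi> where \<xi>: "\<And>k. m (\<xi> k) = \<alpha> / 4 ^ k" "\<xi> 0 = l"
    by metis
  have \<xi>_less: "\<xi> (Suc k) < \<xi> k" for k
  proof -
    have "m (\<xi> (Suc k)) < m (\<xi> k)" using \<alpha> by (simp add: \<xi>(1) divide_strict_left_mono)
    then show ?thesis using m_mono[of "\<xi> k" "\<xi> (Suc k)"] by linarith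
  qed
  have \<xi>_le: "\<xi> k \<le> \<xi> j" if "j \<le> k" for j k
    by (rule lift_Suc_antimono_le[of \<xi>, OF less_imp_le[OF \<xi>_less] that])
  define B where "B k = A \<inter> {\<xi> (Suc k)<..\<xi> k}" for k
  have B [measurable]: "B k \<in> sets borel" for k
    unfolding B_def by measurable
  have B_meas: "emeasure lborel (B k) = ennreal (3 / 4 * \<alpha> / 4 ^ k)" for k
  proof -
    have "emeasure lborel (B k) = ennreal (measure lborel (B k))"
      unfolding B_def by (intro emeasure_eq_measure2 fmeasurableD2 fin) auto
    then show ?thesis
      unfolding B_def m_diff[OF less_imp_le[OF \<xi>_less]] \<xi> by (simp add: field_simps)
  qed
  have B_m: "\<alpha> / 4 ^ Suc k \<le> m x" "m x \<le> \<alpha> / 4 ^ k" if "x \<in> B k" for x k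
    using that m_mono[of "\<xi> (Suc k)" x] m_mono[of x "\<xi> k"] by (auto simp: B_def \<xi>(1))
  have B_disj: "j = k" if "x \<in> B j" "x \<in> B k" for x j k
  proof (rule ccontr)
    assume "j \<noteq> k"
    then have "\<xi> k \<le> \<xi> (Suc j) \<or> \<xi> j \<le> \<xi> (Suc k)"
      by (metis \<xi>_le Suc_leI linorder_neqE_nat)
    then show False using that by (auto simp: B_def)
  qed
  have B_cover: "\<exists>k. x \<in> B k" if x: "x \<in> A" "m x > 0" for x
  proof -
    have "(\<lambda>k. \<alpha> / 4 ^ k) \<longlonglongrightarrow> 0" by (rule LIMSEQ_divide_realpow_zero) simp
    then have "\<forall>\<^sub>F k in sequentially. \<alpha> / 4 ^ k < m x" using x by (intro order_tendstoD)
    then obtain k where "m (\<xi> k) < m x" unfolding \<xi> using eventually_happens'[OF sequentially_bot] by blast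
    then have k: "\<xi> k < x" using m_mono[of x "\<xi> k"] by force
    define j where "j = (LEAST k. \<xi> k < x)"
    have j: "\<xi> j < x" unfolding j_def using k by (rule LeastI)
    moreover have "x \<le> l" using x Al by auto
    ultimately have "j \<noteq> 0" using \<xi>(2) by (cases "j = 0") auto
    then obtain i where i: "j = Suc i" by (cases j) auto
    then have "\<not> \<xi> i < x" using not_less_Least[of i "\<lambda>k. \<xi> k < x"] by (simp add: j_def)
    then have "x \<in> B i" using j i x by (auto simp: B_def)
    then show ?thesis ..
  qed
  define f where "f x = complex_of_real (indicator A x * m x powr (- 1 / 2))" for x
  have f_meas [measurable]: "f \<in> borel_measurable borel" unfolding f_def by measurable
  have norm_f: "cmod (f x) = indicator A x * m x powr (- 1 / 2)" for x
    by (simp add: f_def norm_mult indicator_def)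
  \<comment> \<open>The ratio of the geometric series: from one piece to the next the bound for
    \<open>|f|\<^sup>p\<close> grows by \<open>4 powr (p / 2)\<close>, while the measure drops by
    4.\<close>
  define \<rho> where "\<rho> = (4::real) powr (p / 2 - 1)"
  have \<rho>: "0 < \<rho>" "\<rho> < 1"
    using p powr_less_mono[of "p / 2 - 1" 0 "4::real"] by (auto simp: \<rho>_def)
  define C where "C = 3 / 4 * \<alpha> * (\<alpha> / 4) powr (- p / 2)"
  have C: "C \<ge> 0" using \<alpha> by (simp add: C_def)
  have "(\<integral>\<^sup>+x. ennreal (cmod (f x) powr p) \<partial>lborel)
    \<le> (\<integral>\<^sup>+x. (\<Sum>k. ennreal ((\<alpha> / 4 ^ Suc k) powr (- p / 2)) * indicator (B k) x) \<partial>lborel)"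
  proof (intro nn_integral_mono)
    fix x
    show "ennreal (cmod (f x) powr p) \<le> (\<Sum>k. ennreal ((\<alpha> / 4 ^ Suc k) powr (- p / 2)) * indicator (B k) x)"
    proof (cases "x \<in> A \<and> m x > 0")
      case True
      then obtain k where k: "x \<in> B k" using B_cover by blast
      have "cmod (f x) powr p = m x powr (- p / 2)"
        using True by (simp add: norm_f powr_powr)
      also have "\<dots> \<le> (\<alpha> / 4 ^ Suc k) powr (- p / 2)"
        using B_m[OF k] \<alpha> p by (intro powr_mono2') auto
      finally have "ennreal (cmod (f x) powr p)
        \<le> (\<Sum>j\<in>{k}. ennreal ((\<alpha> / 4 ^ Suc j) powr (- p / 2)) * indicator (B j) x)"
        using k by (simp add: ennreal_leI)
      also have "\<dots> \<le> (\<Sum>j. ennreal ((\<alpha> / 4 ^ Suc j) powr (- p / 2)) * indicator (B j) x)"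
        by (intro sum_le_suminf) auto
      finally show ?thesis .
    next
      case False
      \<comment> \<open>Points of \<open>A\<close> with \<open>m x = 0\<close> lie in no piece, but
        \<open>0 powr (- 1 / 2)\<close> is 0, so f vanishes there.\<close>
      then have "cmod (f x) = 0"
        using measure_nonneg[of lborel "A \<inter> {..x}"] by (auto simp: norm_f m_def less_le)
      then show ?thesis by simp
    qed
  qed
  also have "\<dots> = (\<Sum>k. ennreal ((\<alpha> / 4 ^ Suc k) powr (- p / 2)) * emeasure lborel (B k))"
    by (subst nn_integral_suminf) (auto simp: nn_integral_cmult_indicator)
  also have "\<dots> = (\<Sum>k. ennreal (C * \<rho> ^ k))"
  proof (intro suminf_cong)
    fix k
    have "(\<alpha> / 4 ^ Suc k) powr (- p / 2) * (3 / 4 * \<alpha> / 4 ^ k) = C * \<rho> ^ k"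
    proof -
      have "(\<alpha> / 4 ^ Suc k) powr (- p / 2) = (\<alpha> / 4) powr (- p / 2) * (1 / 4 ^ k) powr (- p / 2)"
        using \<alpha> by (simp flip: powr_mult)
      moreover have "(1 / 4 ^ k :: real) powr (- p / 2) / 4 ^ k = \<rho> ^ k"
        by (simp add: \<rho>_def powr_divide powr_power powr_minus powr_diff divide_simps powr_powr mult.commute flip: powr_realpow)
      ultimately show ?thesis by (simp add: C_def field_simps)
    qed
    then show "ennreal ((\<alpha> / 4 ^ Suc k) powr (- p / 2)) * emeasure lborel (B k) = ennreal (C * \<rho> ^ k)"
      unfolding B_meas by (metis ennreal_mult' powr_ge_zero)
  qed
  also have "\<dots> = ennreal (\<Sum>k. C * \<rho> ^ k)"
    using C \<rho> by (intro suminf_ennreal2) (auto intro!: summable_mult summable_geometric)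
  also have "\<dots> < \<infinity>" by simp
  finally have "f \<in> Lp_space p" by (simp add: Lp_space_iff)
  moreover have "\<exists>N>0. ennreal (3 / 4 * real n)
      \<le> (\<integral>\<^sup>+x. ennreal (indicator A x * (min (cmod (f x)) N)\<^sup>2) \<partial>lborel)" for n :: nat
  proof (intro exI conjI)
    \<comment> \<open>The value of \<open>m powr (- 1 / 2)\<close> at the level of
      \<open>\<xi> n\<close>. On the pieces \<open>B k\<close> with k < n the function stays below
      it, so the truncation does not touch them.\<close>
    define N where "N = (\<alpha> / 4 ^ n) powr (- 1 / 2)"
    show "N > 0" using \<alpha> by (simp add: N_def)
    have "ennreal (3 / 4 * real n) = (\<Sum>k<n. ennreal (4 ^ k / \<alpha>) * emeasure lborel (B k))"
      using \<alpha> by (simp add: B_meas ennreal_of_nat_eq_real_of_nat mult.commute flip: ennreal_mult)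
    also have "\<dots> = (\<integral>\<^sup>+x. (\<Sum>k<n. ennreal (4 ^ k / \<alpha>) * indicator (B k) x) \<partial>lborel)"
      by (subst nn_integral_sum) (simp_all add: nn_integral_cmult_indicator)
    also have "\<dots> \<le> (\<integral>\<^sup>+x. ennreal (indicator A x * (min (cmod (f x)) N)\<^sup>2) \<partial>lborel)"
    proof (intro nn_integral_mono)
      fix x
      show "(\<Sum>k<n. ennreal (4 ^ k / \<alpha>) * indicator (B k) x) \<le> ennreal (indicator A x * (min (cmod (f x)) N)\<^sup>2)"
      proof (cases "\<exists>k<n. x \<in> B k")
        case True
        then obtain k where k: "k < n" "x \<in> B k" by auto
        have "(\<Sum>j<n. ennreal (4 ^ j / \<alpha>) * indicator (B j) x) = (\<Sum>j<n. if j = k then ennreal (4 ^ k / \<alpha>) else 0)"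
        proof (intro sum.cong refl)
          fix j
          have "x \<in> B j \<longleftrightarrow> j = k" using B_disj[of x j k] k(2) by blast
          then show "ennreal (4 ^ j / \<alpha>) * indicator (B j) x = (if j = k then ennreal (4 ^ k / \<alpha>) else 0)"
            by (simp add: indicator_def)
        qed
        also have "\<dots> = ennreal (4 ^ k / \<alpha>)" using k by simp
        also have "\<dots> \<le> ennreal (indicator A x * (min (cmod (f x)) N)\<^sup>2)"
        proof (rule ennreal_leI)
          have x: "x \<in> A" using k by (simp add: B_def)
          have "m x \<ge> \<alpha> / 4 ^ Suc k" "\<alpha> / 4 ^ Suc k \<ge> \<alpha> / 4 ^ n"
            using B_m[OF k(2)] k(1) \<alpha> by (auto intro!: divide_left_mono power_increasing simp del: power_Suc)
          then have mx: "m x \<ge> \<alpha> / 4 ^ n" by linarith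
          have mx0: "m x > 0" by (rule less_le_trans[OF _ mx]) (use \<alpha> in simp)
          have "cmod (f x) \<le> N"
            unfolding norm_f N_def using x mx \<alpha> by (simp, intro powr_mono2') auto
          then have "(min (cmod (f x)) N)\<^sup>2 = (m x powr (- 1 / 2))\<^sup>2"
            using x by (simp add: norm_f min_def)
          also have "\<dots> = 1 / m x"
            using mx0 by (simp add: power2_eq_square powr_neg_one flip: powr_add)
          also have "\<dots> \<ge> 4 ^ k / \<alpha>"
            using B_m(2)[OF k(2)] mx0 \<alpha> by (simp add: field_simps)
          finally show "4 ^ k / \<alpha> \<le> indicator A x * (min (cmod (f x)) N)\<^sup>2"
            using x by simp
        qed
        finally show ?thesis .
      qed auto
    qed
    finally show "ennreal (3 / 4 * real n)
      \<le> (\<integral>\<^sup>+x. ennreal (indicator A x * (min (cmod (f x)) N)\<^sup>2) \<partial>lborel)" .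
  qed
  ultimately show ?thesis by (rule that)
qed

subsection \<open>Gabor expansions\<close>

lemma gabor_in_Lp_space:
  assumes "g \<in> Lp_space p"
  shows "gabor g t s \<in> Lp_space p"
proof -
  have [measurable]: "g \<in> borel_measurable borel" using assms by (rule Lp_space_measurable)
  have "(\<integral>\<^sup>+x. ennreal (cmod (g (x - t)) powr p) \<partial>lborel) = (\<integral>\<^sup>+x. ennreal (cmod (g x) powr p) \<partial>lborel)"
    by (intro nn_integral_translate) simp
  moreover have "gabor g t s \<in> borel_measurable borel"
    unfolding gabor_def by measurable
  ultimately show ?thesis
    using assms by (simp add: Lp_space_iff gabor_character norm_mult)
qed

text \<open>\<open>B\<close> is uniform over all finite partial sums. If g vanishes almost
  everywhere, so do the sums; otherwise some interval carries mass of g, and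
  \<open>fiber_bound\<close> feeds \<open>gabor_sum_square_integral_bound\<close>.\<close>

lemma uncond_gabor_sums_locally_L2:
  fixes g :: "real \<Rightarrow> complex" and p l N :: real
  assumes g: "g \<in> Lp_space p" and f: "f \<in> Lp_space p" and p: "1 < p" "p < 2" and l: "0 < l"
    and sep: "\<And>t t'. t \<in> fst ` \<Lambda> \<Longrightarrow> t' \<in> fst ` \<Lambda> \<Longrightarrow> t \<noteq> t' \<Longrightarrow> l < \<bar>t - t'\<bar>"
    and A: "A \<subseteq> {0..l}"
    and N: "\<And>F x. finite F \<Longrightarrow> F \<subseteq> fst ` \<Lambda> \<Longrightarrow> x \<in> A \<Longrightarrow> (\<Sum>\<tau>\<in>F. cmod (g (x - \<tau>)) powr p) \<le> N"
    and sums: "Lp_uncond_sums p c (\<lambda>(t, s). gabor g t s) \<Lambda> f"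
  obtains B where "0 \<le> B" "\<And>F. finite F \<Longrightarrow> F \<subseteq> \<Lambda> \<Longrightarrow>
    (\<integral>\<^sup>+x. ennreal (indicator A x * (cmod (\<Sum>i\<in>F. c i * gabor g (fst i) (snd i) x))\<^sup>2) \<partial>lborel) \<le> ennreal B"
proof (cases "(\<integral>\<^sup>+x. ennreal (cmod (g x) powr p) \<partial>lborel) = 0")
  case True
  have g_meas [measurable]: "g \<in> borel_measurable borel" using g by (rule Lp_space_measurable)
  have "(\<integral>\<^sup>+x. ennreal (cmod (g (x - t)) powr p) \<partial>lborel) = 0" for t
    using True nn_integral_translate[of "\<lambda>x. ennreal (cmod (g x) powr p)" t] by simp
  then have null: "AE x in lborel. g (x - t) = 0" for t
    by (subst (asm) nn_integral_0_iff_AE) auto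
  have "(\<integral>\<^sup>+x. ennreal (indicator A x * (cmod (\<Sum>i\<in>F. c i * gabor g (fst i) (snd i) x))\<^sup>2) \<partial>lborel) \<le> ennreal 0"
    if "finite F" for F
  proof -
    have "AE x in lborel. \<forall>i\<in>F. g (x - fst i) = 0"
      using that null by (simp add: AE_finite_all)
    then have "AE x in lborel. ennreal (indicator A x * (cmod (\<Sum>i\<in>F. c i * gabor g (fst i) (snd i) x))\<^sup>2) = 0"
      by eventually_elim (simp add: gabor_def)
    from nn_integral_cong_AE[OF this] show ?thesis by simp
  qed
  then show ?thesis using that[of 0] by blast
next
  case False
  have g_meas: "g \<in> borel_measurable borel" using g by (rule Lp_space_measurable)
  obtain a G where G: "0 < G"
    "ennreal G \<le> (\<integral>\<^sup>+z. ennreal (indicator {a..a + l} z * cmod (g z) powr p) \<partial>lborel)"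
    by (rule exists_interval_mass[OF g_meas l False])
  have u: "(case i of (t, s) \<Rightarrow> gabor g t s) \<in> Lp_space p" for i
    using gabor_in_Lp_space[OF g] by (simp add: case_prod_beta)
  obtain K where K: "K \<ge> 0"
    "\<And>F. finite F \<Longrightarrow> F \<subseteq> \<Lambda> \<Longrightarrow> multiplier_bound lborel F (\<lambda>i x. c i * (case i of (t, s) \<Rightarrow> gabor g t s) x) p K"
    using uncond_sums_multiplier_bound[OF sums f u less_imp_le[OF p(1)] less_imp_le[OF p(2)]] by metis
  define B where "B = N powr (2 / p) * (2 * l * (64 * 256 powr p * K / G) powr (2 / p))"
  show ?thesis
  proof (rule that[of B])
    show "0 \<le> B" using l by (simp add: B_def)
    fix F assume F: "finite F" "F \<subseteq> \<Lambda>"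
    show "(\<integral>\<^sup>+x. ennreal (indicator A x * (cmod (\<Sum>i\<in>F. c i * gabor g (fst i) (snd i) x))\<^sup>2) \<partial>lborel) \<le> ennreal B"
      unfolding B_def
    proof (rule gabor_sum_square_integral_bound[OF F(1) g_meas _ _ l _ A])
      show "(\<Sum>\<tau>\<in>fst ` F. integral {0..l} (\<lambda>x. (cmod (fiber F c \<tau> x))\<^sup>2))
        \<le> 2 * l * (64 * 256 powr p * K / G) powr (2 / p)"
        using K(2)[OF F] F p
        by (intro fiber_bound[OF F(1) g_meas _ _ K(1) l sep _ G]) (auto simp: case_prod_beta)
      show "(\<Sum>\<tau>\<in>fst ` F. cmod (g (x - \<tau>)) powr p) \<le> N" if "x \<in> A" for x
        using F that by (intro N) auto
    qed (use p in auto)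
  qed
qed

text \<open>Carries an \<open>L\<^sup>2\<close> bound from partial sums to their limit although
  convergence holds in \<open>L\<^sup>p\<close> only: an error cut off at height N has square at
  most \<open>N powr (2 - p)\<close> times its p-th power.\<close>

lemma truncated_square_le:
  fixes z w :: complex and p N :: real
  assumes "0 < N" "0 \<le> p" "p \<le> 2"
  shows "(min (cmod z) N)\<^sup>2 \<le> 2 * (cmod w)\<^sup>2 + 2 * N powr (2 - p) * cmod (z - w) powr p"
proof -
  define u where "u = min (cmod (z - w)) N"
  have u: "0 \<le> u" "u \<le> N" "u \<le> cmod (z - w)" using assms by (auto simp: u_def)
  have "cmod z \<le> cmod w + cmod (z - w)"
    using norm_triangle_ineq[of w "z - w"] by simp
  then have "min (cmod z) N \<le> cmod w + u" 
    using norm_ge_zero[of w] by (simp add: u_def min_def del: norm_ge_zero)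
  then have "(min (cmod z) N)\<^sup>2 \<le> (cmod w + u)\<^sup>2"
    using assms by (intro power_mono) auto
  also have "\<dots> \<le> 2 * (cmod w)\<^sup>2 + 2 * u\<^sup>2"
    using sum_squares_bound[of "cmod w" u] by (simp add: power2_sum)
  also have "u\<^sup>2 \<le> N powr (2 - p) * cmod (z - w) powr p"
  proof (cases "cmod (z - w) \<le> N")
    case True
    have "u\<^sup>2 = cmod (z - w) powr (2 - p) * cmod (z - w) powr p"
      using True by (cases "z = w") (auto simp: u_def min_def simp flip: powr_add)
    also have "\<dots> \<le> N powr (2 - p) * cmod (z - w) powr p"
      using True assms by (intro mult_right_mono powr_mono2) auto
    finally show ?thesis .
  next
    case False
    have "u\<^sup>2 = N powr (2 - p) * N powr p"
      using False assms by (simp add: u_def min_def flip: powr_add)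
    also have "\<dots> \<le> N powr (2 - p) * cmod (z - w) powr p"
      using False assms by (intro mult_left_mono powr_mono2) auto
    finally show ?thesis .
  qed
  finally show ?thesis by (simp add: mult.assoc)
qed

text \<open>The set \<open>A\<close> and the function \<open>f\<close> are fixed before any
  coefficients are considered, so one \<open>f\<close> defeats every choice of \<open>c\<close>.
  This covers frames and bases alike.\<close>

lemma exists_function_without_uncond_gabor_expansion:
  fixes p :: real and T :: "real set" and \<Lambda> :: "(real \<times> real) set"
  assumes p: "1 < p" "p < 2" and T: "uniformly_discrete T" "\<Lambda> \<subseteq> T \<times> UNIV" "countable \<Lambda>"
    and g: "g \<in> Lp_space p"
  obtains f where "f \<in> Lp_space p" "\<And>c. \<not> Lp_uncond_sums p c (\<lambda>(t, s). gabor g t s) \<Lambda> f"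
proof -
  obtain \<delta> where \<delta>: "\<delta> > 0" "\<And>t t'. t \<in> T \<Longrightarrow> t' \<in> T \<Longrightarrow> t \<noteq> t' \<Longrightarrow> \<delta> \<le> \<bar>t - t'\<bar>"
    using T(1) unfolding uniformly_discrete_def by blast
  \<comment> \<open>Halving turns separation by at least \<open>\<delta>\<close> into separation by
    strictly more than \<open>l\<close>, as needed for closed intervals of length \<open>l\<close>
    to be disjoint.\<close>
  define l where "l = \<delta> / 2"
  have l: "l > 0" using \<delta> by (simp add: l_def)
  have sep: "l < \<bar>t - t'\<bar>" if "t \<in> fst ` \<Lambda>" "t' \<in> fst ` \<Lambda>" "t \<noteq> t'" for t t'
    using \<delta>(2)[of t t'] that T(2) \<delta>(1) by (force simp: l_def)
  obtain A and N :: real where A [measurable]: "A \<in> sets borel" and Al: "A \<subseteq> {0..l}" and A0: "0 < measure lborel A"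
    and N: "\<And>F x. finite F \<Longrightarrow> F \<subseteq> fst ` \<Lambda> \<Longrightarrow> x \<in> A \<Longrightarrow> (\<Sum>\<tau>\<in>F. cmod (g (x - \<tau>)) powr p) \<le> N"
    using exists_set_bounded_translates[OF g countable_image[OF T(3)] l sep] by blast
  obtain f where f: "f \<in> Lp_space p" and large: "\<And>n::nat. \<exists>R>0. ennreal (3 / 4 * real n)
      \<le> (\<integral>\<^sup>+x. ennreal (indicator A x * (min (cmod (f x)) R)\<^sup>2) \<partial>lborel)"
    using exists_Lp_not_locally_L2[OF A Al A0, of p] p by auto
  have "\<not> Lp_uncond_sums p c (\<lambda>(t, s). gabor g t s) \<Lambda> f" for c
  proof
    assume sums: "Lp_uncond_sums p c (\<lambda>(t, s). gabor g t s) \<Lambda> f"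
    note [measurable] = f[THEN Lp_space_measurable] gabor_in_Lp_space[OF g, THEN Lp_space_measurable]
    define S where "S F x = (\<Sum>i\<in>F. c i * gabor g (fst i) (snd i) x)" for F x
    have [measurable]: "S F \<in> borel_measurable borel" for F
      unfolding S_def by measurable
    obtain B where B: "0 \<le> B" "\<And>F. finite F \<Longrightarrow> F \<subseteq> \<Lambda> \<Longrightarrow>
      (\<integral>\<^sup>+x. ennreal (indicator A x * (cmod (S F x))\<^sup>2) \<partial>lborel) \<le> ennreal B"
      unfolding S_def
      by (rule uncond_gabor_sums_locally_L2[OF g f p l sep Al N sums]) auto
    \<comment> \<open>The order of choices matters: \<open>B\<close> comes first, then
      \<open>n\<close>, then the truncation height \<open>R\<close>, then \<open>\<epsilon>\<close>
      so that the error term is exactly 2, and last a partial sum \<open>F\<close> that is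
      \<open>\<epsilon>\<close>-close to \<open>f\<close>.\<close>
    obtain n :: nat where n: "2 * B + 2 < 3 / 4 * real n"
      using reals_Archimedean2[of "(2 * B + 2) * 4 / 3"] by (auto simp: field_simps)
    obtain R where R: "R > 0" "ennreal (3 / 4 * real n)
      \<le> (\<integral>\<^sup>+x. ennreal (indicator A x * (min (cmod (f x)) R)\<^sup>2) \<partial>lborel)"
      using large by blast
    define \<epsilon> where "\<epsilon> = 1 / R powr (2 - p)"
    have \<epsilon>: "\<epsilon> > 0" using R by (simp add: \<epsilon>_def)
    have "\<forall>\<^sub>F F in finite_subsets_at_top \<Lambda>.
      (\<integral>\<^sup>+x. ennreal (cmod (f x - (\<Sum>i\<in>F. c i * (case i of (t, s) \<Rightarrow> gabor g t s) x)) powr p) \<partial>lborel) \<le> ennreal \<epsilon>"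
      using uncond_sums_eventually[OF sums f _ _ _ \<epsilon>] p gabor_in_Lp_space[OF g] by (auto split: prod.splits)
    then obtain F where F: "finite F" "F \<subseteq> \<Lambda>"
      "(\<integral>\<^sup>+x. ennreal (cmod (f x - S F x) powr p) \<partial>lborel) \<le> ennreal \<epsilon>"
      by (auto simp: eventually_finite_subsets_at_top S_def case_prod_beta)
    have "(\<integral>\<^sup>+x. ennreal (indicator A x * (min (cmod (f x)) R)\<^sup>2) \<partial>lborel)
      \<le> (\<integral>\<^sup>+x. 2 * ennreal (indicator A x * (cmod (S F x))\<^sup>2)
          + ennreal (2 * R powr (2 - p)) * ennreal (cmod (f x - S F x) powr p) \<partial>lborel)"
    proof (intro nn_integral_mono)
      fix x
      have "indicator A x * (min (cmod (f x)) R)\<^sup>2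
        \<le> 2 * (indicator A x * (cmod (S F x))\<^sup>2) + 2 * R powr (2 - p) * cmod (f x - S F x) powr p"
        using truncated_square_le[of R p "f x" "S F x"] R p by (cases "x \<in> A") auto
      then show "ennreal (indicator A x * (min (cmod (f x)) R)\<^sup>2)
        \<le> 2 * ennreal (indicator A x * (cmod (S F x))\<^sup>2)
          + ennreal (2 * R powr (2 - p)) * ennreal (cmod (f x - S F x) powr p)"
        by (simp add: ennreal_leI flip: ennreal_numeral ennreal_mult ennreal_plus)
    qed
    also have "\<dots> = 2 * (\<integral>\<^sup>+x. ennreal (indicator A x * (cmod (S F x))\<^sup>2) \<partial>lborel)
        + ennreal (2 * R powr (2 - p)) * (\<integral>\<^sup>+x. ennreal (cmod (f x - S F x) powr p) \<partial>lborel)"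
      by (simp add: nn_integral_add nn_integral_cmult)
    also have "\<dots> \<le> 2 * ennreal B + ennreal (2 * R powr (2 - p)) * ennreal \<epsilon>"
      using F B(2)[of F] by (intro add_mono mult_left_mono) auto
    also have "\<dots> = ennreal (2 * B + 2 * R powr (2 - p) * \<epsilon>)"
      using B(1) \<epsilon> by (simp flip: ennreal_numeral ennreal_mult ennreal_plus)
    also have "2 * R powr (2 - p) * \<epsilon> = 2" using R by (simp add: \<epsilon>_def)
    finally have "ennreal (3 / 4 * real n) \<le> ennreal (2 * B + 2)"
      using R(2) by (rule order_trans[rotated])
    then have "3 / 4 * real n \<le> 2 * B + 2"
      using B(1) by (subst (asm) ennreal_le_iff) auto
    then show False using n by simp
  qed
  then show ?thesis using f that by blast
qed

theorem theorem2p4: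
  fixes p :: real and T :: "real set" and \<Lambda> :: "(real \<times> real) set"
  assumes "1 < p" and "p < 2"
    and "uniformly_discrete T"
    and "\<Lambda> \<subseteq> T \<times> UNIV"
    and "countable \<Lambda>"
  shows "(\<forall>g\<in>Lp_space p. \<forall>gs :: real \<times> real \<Rightarrow> (real \<Rightarrow> complex) \<Rightarrow> complex.
            (\<forall>ts\<in>\<Lambda>. gs ts \<in> Lp_dual p) \<longrightarrow>
            \<not> uncond_schauder_frame p (\<lambda>(t, s). gabor g t s) gs \<Lambda>)
       \<and> (\<forall>g\<in>Lp_space p. \<not> uncond_basis p (\<lambda>(t, s). gabor g t s) \<Lambda>)"
proof (intro conjI ballI allI impI)
  fix g gs assume "g \<in> Lp_space p"
  then obtain f where f: "f \<in> Lp_space p" "\<And>c. \<not> Lp_uncond_sums p c (\<lambda>(t, s). gabor g t s) \<Lambda> f"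
    using exists_function_without_uncond_gabor_expansion[OF assms] by blast
  \<comment> \<open>A frame would expand \<open>f\<close> with the coefficients
    \<open>gs i f\<close>, one instance of \<open>c\<close>.\<close>
  show "\<not> uncond_schauder_frame p (\<lambda>(t, s). gabor g t s) gs \<Lambda>"
    using f by (auto simp: uncond_schauder_frame_def)
next
  fix g assume "g \<in> Lp_space p"
  then obtain f where f: "f \<in> Lp_space p" "\<And>c. \<not> Lp_uncond_sums p c (\<lambda>(t, s). gabor g t s) \<Lambda> f"
    using exists_function_without_uncond_gabor_expansion[OF assms] by blast
  show "\<not> uncond_basis p (\<lambda>(t, s). gabor g t s) \<Lambda>"
    using f unfolding uncond_basis_def by blast
qed

end
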